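(* The pure braid group $\mathrm{PBr}_{A_n}$ has a presentation with generators given by the connected subgraphs $\mathcal A\subseteq A_n$ (where the generator $\mathcal A$ corresponds to the element $\ell_{\mathcal A}^2\in \mathrm{PBr}_{A_n}$), subject to the relations: (1) $\mathcal A\cdot\mathcal B=\mathcal B\cdot\mathcal A$ if $d(\mathcal A,\mathcal B)\ge 2$, or $\mathcal A\subseteq\mathcal B$, or $\mathcal B\subseteq\mathcal A$. (2) For all $\mathcal A$ and all $\mathcal C$ such that $d(\mathcal A,\mathcal C)=2$, $$(\mathcal A\cup\mathcal B)^{-1}\cdot(\mathcal A\cdot\mathcal B\cdot\mathcal C)\cdot(\mathcal B\cup\mathcal C)^{-1}=(\mathcal C\cup\mathcal B)^{-1}\cdot(\mathcal C\cdot\mathcal B\cdot\mathcal A)\cdot(\mathcal B\cup\mathcal A)^{-1}$$ for all $\mathcal B$ compatible with $(\mathcal A,\mathcal C)$.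
   Context: Let $n\ge 1$. The braid group $\mathrm{Br}_{n+1}$ is the group with generators $s_1,\dots,s_n$ and relations $s_is_j=s_js_i$ for $|i-j|\ge 2$ and $s_is_{i+1}s_i=s_{i+1}s_is_{i+1}$ for $1\le i\le n-1$. The pure braid group $\mathrm{PBr}_{A_n}$ is the kernel of the homomorphism $\mathrm{Br}_{n+1}\to\mathfrak{S}_{n+1}$ sending $s_i$ to the transposition $(i,i+1)$. $A_n$ denotes the path graph (Dynkin graph) with nodes $1,2,\dots,n$ and edges between consecutive nodes. A (nonempty) connected subgraph is an interval $[i,j]=\{i,i+1,\dots,j\}$ with $1\le i\le j\le n$. For $\mathcal A=[i,j]$, $\ell_{\mathcal A}=\ell_{i,j}\in \mathrm{Br}_{n+1}$ denotes the standard positive lift of the longest element of the parabolic subgroup of $\mathfrak{S}_{n+1}$ generated by $(i,i+1),\dots,(j,j+1)$; explicitly $\ell_{i,j}=(s_i)(s_{i+1}s_i)(s_{i+2}s_{i+1}s_i)\cdots(s_j s_{j-1}\cdots s_i)$, with $\ell_{i,i}=s_i$. By abuse of notation one writes $\mathcal A$ for $\ell_{\mathcal A}^2$. Distance: $d(\mathcal A,\mathcal B)=0$ if $\mathcal A\cap\mathcal B\ne\emptyset$; otherwise $d(\mathcal A,\mathcal B)$ is the number of edges between $\mathcal A$ and $\mathcal B$, i.e. if $\mathcal A=[i,j]$ and $\mathcal B=[k,l]$ with $j<k$, then $d(\mathcal A,\mathcal B)=k-j$. Thus $d(\mathcal A,\mathcal C)=2$ means $\mathcal A$ and $\mathcal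 C$ are precisely one node apart. Compatibility: if $d(\mathcal A,\mathcal C)=2$, and (say) $\mathcal A=[i,j]$ is to the left, $\mathcal C=[j+2,p]$, then a connected subgraph $\mathcal B=[a,k]$ is compatible with $(\mathcal A,\mathcal C)$ if it contains the node $j+1$ and is contained in $[i+1,p-1]$, i.e. $i<a\le j+1\le k<p$. (If $\mathcal A$ is to the right of $\mathcal C$, the roles are exchanged.) The unions $\mathcal A\cup\mathcal B=[i,k]$ and $\mathcal B\cup\mathcal C=[a,p]$ are again connected subgraphs. *)

theory Defs
  imports "HOL-Algebra.Sym_Groups"
begin

section \<open>Group presentations\<close>

datatype 'a letter = Gen 'a | Inv 'a

fun flip :: "'a letter \<Rightarrow> 'a letter" where
  "flip (Gen x) = Inv x"
| "flip (Inv x) = Gen x"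

definition words :: "'a set \<Rightarrow> 'a letter list set" where
  "words X = lists (Gen ` X \<union> Inv ` X)"

text \<open>A relation \<open>l = r\<close> between words is the pair \<open>(l, r)\<close>.  The relation below is the
  least congruence on the words over \<open>X\<close> that contains all relations in \<open>R\<close> and cancels
  each letter with its formal inverse.\<close>

inductive word_cong ::
    "'a set \<Rightarrow> ('a letter list \<times> 'a letter list) set \<Rightarrow> 'a letter list \<Rightarrow> 'a letter list \<Rightarrow> bool"
  for X R where
  refl: "w \<in> words X \<Longrightarrow> word_cong X R w w"
| sym: "word_cong X R v w \<Longrightarrow> word_cong X R w v"
| trans: "word_cong X R u v \<Longrightarrow> word_cong X R v w \<Longrightarrow> word_cong X R u w"
| cancel: "u @ [a, flip a] @ v \<in> words X \<Longrightarrow> word_cong X R (u @ [a, flip a] @ v) (u @ v)"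
| rel: "(l, r) \<in> R \<Longrightarrow> u @ l @ v \<in> words X \<Longrightarrow> u @ r @ v \<in> words X
          \<Longrightarrow> word_cong X R (u @ l @ v) (u @ r @ v)"

definition word_class ::
    "'a set \<Rightarrow> ('a letter list \<times> 'a letter list) set \<Rightarrow> 'a letter list \<Rightarrow> 'a letter list set" where
  "word_class X R w = {v. word_cong X R w v}"

definition presented_group ::
    "'a set \<Rightarrow> ('a letter list \<times> 'a letter list) set \<Rightarrow> 'a letter list set monoid" where
  "presented_group X R =
     \<lparr> carrier = word_class X R ` words X,
       mult = (\<lambda>C D. \<Union>u\<in>C. \<Union>v\<in>D. word_class X R (u @ v)),
       one = word_class X R [] \<rparr>"

definition has_presentation ::
    "('b, 'c) monoid_scheme \<Rightarrow> 'a set \<Rightarrow> ('a \<Rightarrow> 'b) \<Rightarrow> ('a letter list \<times> 'a letter list) set \<Rightarrow> bool"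
  where
  "has_presentation G X g R \<longleftrightarrow>
     (\<exists>\<phi> \<in> iso (presented_group X R) G. \<forall>x\<in>X. \<phi> (word_class X R [Gen x]) = g x)"

fun eval_letter :: "('b, 'c) monoid_scheme \<Rightarrow> ('a \<Rightarrow> 'b) \<Rightarrow> 'a letter \<Rightarrow> 'b" where
  "eval_letter G f (Gen x) = f x"
| "eval_letter G f (Inv x) = inv\<^bsub>G\<^esub> (f x)"

definition eval_word :: "('b, 'c) monoid_scheme \<Rightarrow> ('a \<Rightarrow> 'b) \<Rightarrow> 'a letter list \<Rightarrow> 'b" where
  "eval_word G f w = foldr (\<lambda>a b. eval_letter G f a \<otimes>\<^bsub>G\<^esub> b) w \<one>\<^bsub>G\<^esub>"

text \<open>The homomorphism out of a presented group that extends \<open>f\<close>: evaluate any representative.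
  It is independent of the representative when \<open>f\<close> respects the relations, see
  \<open>induced_hom_class\<close>.\<close>

definition induced_hom :: "('b, 'c) monoid_scheme \<Rightarrow> ('a \<Rightarrow> 'b) \<Rightarrow> 'a letter list set \<Rightarrow> 'b" where
  "induced_hom G f C = eval_word G f (SOME w. w \<in> C)"

lemma words_append [simp]: "u @ v \<in> words X \<longleftrightarrow> u \<in> words X \<and> v \<in> words X"
  by (simp add: words_def)

lemma words_Nil [simp]: "[] \<in> words X"
  by (simp add: words_def)

lemma words_Cons: "a # w \<in> words X \<longleftrightarrow> a \<in> Gen ` X \<union> Inv ` X \<and> w \<in> words X"
  by (auto simp: words_def)

lemma word_cong_words: "word_cong X R u v \<Longrightarrow> u \<in> words X \<and> v \<in> words X"
  by (induction rule: word_cong.induct) (auto simp: words_Cons)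

lemma word_cong_append:
  assumes "word_cong X R u v" "a \<in> words X" "b \<in> words X"
  shows "word_cong X R (a @ u @ b) (a @ v @ b)"
  using assms
proof (induction rule: word_cong.induct)
  case (refl w) then show ?case by (intro word_cong.refl) simp
next
  case (sym v w) then show ?case by (blast intro: word_cong.sym)
next
  case (trans u v w) then show ?case by (blast intro: word_cong.trans)
next
  case (cancel u c v)
  then show ?case using word_cong.cancel[of "a @ u" c "v @ b" X R] by (simp add: words_Cons)
next
  case (rel l r u v)
  then show ?case using word_cong.rel[of l r R "a @ u" "v @ b" X] by simp
qed

lemma word_cong_append2:
  assumes "word_cong X R u u'" "word_cong X R v v'"
  shows "word_cong X R (u @ v) (u' @ v')"
proof -
  have "word_cong X R (u @ v) (u' @ v)"
    using word_cong_append[OF assms(1), of "[]" v] word_cong_words[OF assms(2)] by simp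
  moreover have "word_cong X R (u' @ v) (u' @ v')"
    using word_cong_append[OF assms(2), of u' "[]"] word_cong_words[OF assms(1)] by simp
  ultimately show ?thesis by (rule word_cong.trans)
qed

lemma word_class_eq_iff:
  assumes "u \<in> words X"
  shows "word_class X R u = word_class X R v \<longleftrightarrow> word_cong X R u v"
  unfolding word_class_def
  using word_cong.refl[OF assms] word_cong.sym word_cong.trans by blast

lemma mult_word_class:
  assumes "u \<in> words X" "v \<in> words X"
  shows "word_class X R u \<otimes>\<^bsub>presented_group X R\<^esub> word_class X R v = word_class X R (u @ v)"
proof -
  have "word_class X R (u' @ v') = word_class X R (u @ v)"
    if "u' \<in> word_class X R u" "v' \<in> word_class X R v" for u' v'
    using that word_cong_append2[of X R u u' v v'] assms
    by (metis mem_Collect_eq word_class_def word_class_eq_iff words_append)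
  moreover have "u \<in> word_class X R u" "v \<in> word_class X R v"
    using assms by (auto simp: word_class_def word_cong.refl)
  ultimately have "(\<Union>u'\<in>word_class X R u. \<Union>v'\<in>word_class X R v. word_class X R (u' @ v'))
      = word_class X R (u @ v)"
    by blast
  then show ?thesis
    by (simp add: presented_group_def)
qed

lemma group_presented_group: "group (presented_group X R)"
proof (rule groupI)
  let ?G = "presented_group X R"
  have carr: "carrier ?G = word_class X R ` words X" and one: "\<one>\<^bsub>?G\<^esub> = word_class X R []"
    by (simp_all add: presented_group_def)
  fix x assume x: "x \<in> carrier ?G"
  then obtain u where u: "u \<in> words X" "x = word_class X R u" by (auto simp: carr)
  show "\<one>\<^bsub>?G\<^esub> \<otimes>\<^bsub>?G\<^esub> x = x"
    using u by (simp add: one mult_word_class)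
  have "\<exists>w\<in>words X. word_cong X R (w @ u) []"
    using u(1)
  proof (induction u)
    case Nil then show ?case using word_cong.refl[of "[]" X R] by auto
  next
    case (Cons a u)
    then obtain w where w: "w \<in> words X" "word_cong X R (w @ u) []"
      by (auto simp: words_Cons)
    have a: "[flip a, a] \<in> words X" "flip (flip a) = a"
      using Cons.prems by (auto simp: words_Cons)
    have "word_cong X R (w @ [flip a, flip (flip a)] @ u) (w @ u)"
      by (rule word_cong.cancel) (use a w Cons.prems in \<open>auto simp: words_Cons\<close>)
    then have "word_cong X R ((w @ [flip a]) @ a # u) []"
      using a w(2) by (auto intro: word_cong.trans)
    then show ?case using w(1) a(1) by (intro bexI[of _ "w @ [flip a]"]) (auto simp: words_Cons)
  qed
  then obtain w where "w \<in> words X" "word_cong X R (w @ u) []" by blast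
  then show "\<exists>y\<in>carrier ?G. y \<otimes>\<^bsub>?G\<^esub> x = \<one>\<^bsub>?G\<^esub>"
    using u by (intro bexI[of _ "word_class X R w"])
      (auto simp: carr one mult_word_class word_class_eq_iff)
next
  fix x y assume "x \<in> carrier (presented_group X R)" "y \<in> carrier (presented_group X R)"
  then obtain u v where "u \<in> words X" "v \<in> words X" "x = word_class X R u" "y = word_class X R v"
    by (auto simp: presented_group_def)
  then have "x \<otimes>\<^bsub>presented_group X R\<^esub> y = word_class X R (u @ v)" "u @ v \<in> words X"
    by (simp_all add: mult_word_class)
  then show "x \<otimes>\<^bsub>presented_group X R\<^esub> y \<in> carrier (presented_group X R)"
    by (simp add: presented_group_def del: words_append)
next
  fix x y z
  assume "x \<in> carrier (presented_group X R)" "y \<in> carrier (presented_group X R)"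
    "z \<in> carrier (presented_group X R)"
  then obtain u v w where "u \<in> words X" "v \<in> words X" "w \<in> words X"
    "x = word_class X R u" "y = word_class X R v" "z = word_class X R w"
    by (auto simp: presented_group_def)
  then show "x \<otimes>\<^bsub>presented_group X R\<^esub> y \<otimes>\<^bsub>presented_group X R\<^esub> z
           = x \<otimes>\<^bsub>presented_group X R\<^esub> (y \<otimes>\<^bsub>presented_group X R\<^esub> z)"
    by (simp add: mult_word_class)
qed (simp add: presented_group_def)

context group
begin

lemma eval_letter_closed:
  "f ` X \<subseteq> carrier G \<Longrightarrow> a \<in> Gen ` X \<union> Inv ` X \<Longrightarrow> eval_letter G f a \<in> carrier G"
  by auto

lemma eval_word_closed:
  "f ` X \<subseteq> carrier G \<Longrightarrow> w \<in> words X \<Longrightarrow> eval_word G f w \<in> carrier G"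
  by (induction w) (auto simp: words_Cons eval_word_def)

lemma eval_word_append:
  assumes "f ` X \<subseteq> carrier G" "u \<in> words X" "v \<in> words X"
  shows "eval_word G f (u @ v) = eval_word G f u \<otimes> eval_word G f v"
  using assms(2)
proof (induction u)
  case Nil
  then show ?case using eval_word_closed[OF assms(1,3)] by (simp add: eval_word_def)
next
  case (Cons a u)
  then have "eval_letter G f a \<in> carrier G" "u \<in> words X"
    using eval_letter_closed[OF assms(1)] by (auto simp: words_Cons)
  then show ?case
    using Cons eval_word_closed[OF assms(1)] assms(3)
    by (simp add: eval_word_def m_assoc)
qed

lemma eval_word_cong:
  assumes f: "f ` X \<subseteq> carrier G"
    and R: "\<And>l r. (l, r) \<in> R \<Longrightarrow> l \<in> words X \<Longrightarrow> r \<in> words X \<Longrightarrow> eval_word G f l = eval_word G f r"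
    and "word_cong X R u v"
  shows "eval_word G f u = eval_word G f v"
  using assms(3)
proof (induction rule: word_cong.induct)
  case (cancel u a v)
  then have a: "a \<in> Gen ` X \<union> Inv ` X" by (simp add: words_Cons)
  then have "eval_word G f [a, flip a] = \<one>"
    using f by (auto simp: eval_word_def)
  then show ?case
    using cancel eval_word_closed[OF f] by (simp add: eval_word_append[OF f] del: append_Cons)
next
  case (rel l r u v)
  then show ?case by (simp add: eval_word_append[OF f] R)
qed auto

lemma induced_hom_class:
  assumes f: "f ` X \<subseteq> carrier G"
    and R: "\<And>l r. (l, r) \<in> R \<Longrightarrow> l \<in> words X \<Longrightarrow> r \<in> words X \<Longrightarrow> eval_word G f l = eval_word G f r"
    and w: "w \<in> words X"
  shows "induced_hom G f (word_class X R w) = eval_word G f w"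
proof -
  have "w \<in> word_class X R w" using w by (simp add: word_class_def word_cong.refl)
  then have "(SOME v. v \<in> word_class X R w) \<in> word_class X R w" by (rule someI)
  then show ?thesis
    using eval_word_cong[OF f R] by (simp add: induced_hom_def word_class_def)
qed

lemma induced_hom_hom:
  assumes f: "f ` X \<subseteq> carrier G"
    and R: "\<And>l r. (l, r) \<in> R \<Longrightarrow> l \<in> words X \<Longrightarrow> r \<in> words X \<Longrightarrow> eval_word G f l = eval_word G f r"
  shows "induced_hom G f \<in> hom (presented_group X R) G"
proof (rule homI)
  have carr: "carrier (presented_group X R) = word_class X R ` words X"
    by (simp add: presented_group_def)
  fix C assume "C \<in> carrier (presented_group X R)"
  then obtain u where u: "u \<in> words X" "C = word_class X R u" by (auto simp: carr)
  then show "induced_hom G f C \<in> carrier G"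
    using induced_hom_class[OF f R] eval_word_closed[OF f] by simp
  fix D assume "D \<in> carrier (presented_group X R)"
  then obtain v where v: "v \<in> words X" "D = word_class X R v" by (auto simp: carr)
  show "induced_hom G f (C \<otimes>\<^bsub>presented_group X R\<^esub> D) = induced_hom G f C \<otimes> induced_hom G f D"
    using u v by (simp add: mult_word_class induced_hom_class[OF f R] eval_word_append[OF f])
qed

end


section \<open>Braid groups and pure braid groups\<close>

text \<open>The parameter \<open>N\<close> counts strands, so the generators are \<open>1, \<dots>, N - 1\<close>.\<close>

definition braid_relations :: "nat \<Rightarrow> (nat letter list \<times> nat letter list) set" where
  "braid_relations N =
     {([Gen i, Gen j], [Gen j, Gen i]) | i j.
        i \<in> {1..<N} \<and> j \<in> {1..<N} \<and> \<bar>int i - int j\<bar> \<ge> 2}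
   \<union> {([Gen i, Gen (i + 1), Gen i], [Gen (i + 1), Gen i, Gen (i + 1)]) | i.
        i \<in> {1..<N} \<and> i + 1 \<in> {1..<N}}"

definition braid_group :: "nat \<Rightarrow> nat letter list set monoid" where
  "braid_group N = presented_group {1..<N} (braid_relations N)"

definition braid_perm :: "nat \<Rightarrow> nat letter list set \<Rightarrow> nat \<Rightarrow> nat" where
  "braid_perm N = induced_hom (sym_group N) (\<lambda>i. transpose i (i + 1))"

definition pure_braid_group :: "nat \<Rightarrow> nat letter list set monoid" where
  "pure_braid_group N =
     (braid_group N)\<lparr>carrier := kernel (braid_group N) (sym_group N) (braid_perm N)\<rparr>"

lemma transpose_sym_group:
  "(\<lambda>i. transpose i (i + 1)) ` {1..<N} \<subseteq> carrier (sym_group N)"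
  by (force simp: sym_group_carrier intro!: permutes_swap_id)

lemma transpose_braid_relations:
  assumes "(l, r) \<in> braid_relations N"
  shows "eval_word (sym_group N) (\<lambda>i. transpose i (i + 1)) l
       = eval_word (sym_group N) (\<lambda>i. transpose i (i + 1)) r"
proof -
  have comm: "transpose i (i + 1) \<circ> transpose j (j + 1) = transpose j (j + 1) \<circ> transpose i (i + 1)"
    if "\<bar>int i - int j\<bar> \<ge> 2" for i j :: nat
  proof -
    have "i \<noteq> j" "i + 1 \<noteq> j" "i \<noteq> j + 1" using that by auto
    then show ?thesis by (auto simp: fun_eq_iff transpose_def)
  qed
  have braid: "transpose i (i + 1) \<circ> (transpose (i + 1) (i + 2) \<circ> transpose i (i + 1))
            = transpose (i + 1) (i + 2) \<circ> (transpose i (i + 1) \<circ> transpose (i + 1) (i + 2))"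
    for i :: nat
    by (auto simp: fun_eq_iff transpose_def)
  from assms consider
      (far) i j where "\<bar>int i - int j\<bar> \<ge> 2" "l = [Gen i, Gen j]" "r = [Gen j, Gen i]"
    | (near) i where "l = [Gen i, Gen (i + 1), Gen i]" "r = [Gen (i + 1), Gen i, Gen (i + 1)]"
    unfolding braid_relations_def by blast
  then show ?thesis
  proof cases
    case (far i j)
    then show ?thesis
      using comm[of i j]
      by (simp add: eval_word_def sym_group_mult sym_group_one)
  next
    case (near i)
    then show ?thesis
      using braid[of i]
      by (simp add: eval_word_def sym_group_mult sym_group_one)
  qed
qed

lemma braid_perm_hom: "braid_perm N \<in> hom (braid_group N) (sym_group N)"
  unfolding braid_perm_def braid_group_def
  by (intro group.induced_hom_hom sym_group_is_group transpose_sym_group transpose_braid_relations)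

lemma braid_perm_gen:
  assumes "i \<in> {1..<N}"
  shows "braid_perm N (word_class {1..<N} (braid_relations N) [Gen i]) = transpose i (i + 1)"
proof -
  have "[Gen i] \<in> words {1..<N}" using assms by (simp add: words_Cons)
  from group.induced_hom_class[OF sym_group_is_group transpose_sym_group
      transpose_braid_relations this]
  show ?thesis
    by (simp add: braid_perm_def eval_word_def sym_group_mult sym_group_one)
qed


section \<open>Connected subgraphs of the Dynkin graph of type A\<close>

text \<open>A connected subgraph is represented by its set of nodes.\<close>

definition connected_subgraphs :: "nat \<Rightarrow> nat set set" where
  "connected_subgraphs n = {{i..j} | i j. 1 \<le> i \<and> i \<le> j \<and> j \<le> n}"

definition subgraph_dist :: "nat set \<Rightarrow> nat set \<Rightarrow> nat" where
  "subgraph_dist A B =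
     (if A \<inter> B \<noteq> {} then 0
      else if Max A < Min B then Min B - Max A
      else Min A - Max B)"

text \<open>\<open>B\<close> is compatible with \<open>(A, C)\<close>; only used when \<open>A\<close> and \<open>C\<close> are at distance 2, so
  that exactly one node lies between them.\<close>

definition compatible :: "nat set \<Rightarrow> nat set \<Rightarrow> nat set \<Rightarrow> bool" where
  "compatible A C B \<longleftrightarrow>
     (if Max A < Min C
      then Max A + 1 \<in> B \<and> B \<subseteq> {Min A + 1..Max C - 1}
      else Max C + 1 \<in> B \<and> B \<subseteq> {Min C + 1..Max A - 1})"

text \<open>The word \<open>(s\<^sub>i)(s\<^bsub>i+1\<^esub> s\<^sub>i) \<dots> (s\<^sub>j s\<^bsub>j-1\<^esub> \<dots> s\<^sub>i)\<close>.\<close>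

definition half_twist_word :: "nat \<Rightarrow> nat \<Rightarrow> nat letter list" where
  "half_twist_word i j = concat (map (\<lambda>m. map Gen (rev [i..<m + 1])) [i..<j + 1])"

definition half_twist :: "nat \<Rightarrow> nat set \<Rightarrow> nat letter list set" where
  "half_twist n A = word_class {1..<n + 1} (braid_relations (n + 1)) (half_twist_word (Min A) (Max A))"

definition pure_braid_relations :: "nat \<Rightarrow> (nat set letter list \<times> nat set letter list) set" where
  "pure_braid_relations n =
     {([Gen A, Gen B], [Gen B, Gen A]) | A B.
        A \<in> connected_subgraphs n \<and> B \<in> connected_subgraphs n \<and>
        (subgraph_dist A B \<ge> 2 \<or> A \<subseteq> B \<or> B \<subseteq> A)}
   \<union> {([Inv (A \<union> B), Gen A, Gen B, Gen C, Inv (B \<union> C)],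
       [Inv (C \<union> B), Gen C, Gen B, Gen A, Inv (B \<union> A)]) | A B C.
        A \<in> connected_subgraphs n \<and> B \<in> connected_subgraphs n \<and> C \<in> connected_subgraphs n \<and>
        subgraph_dist A C = 2 \<and> compatible A C B}"

end

theory Submission
  imports Defs "HOL-Algebra.Bij"
begin

text \<open>
  Write \<open>T p q\<close> for the full twist on the strands \<open>p, \<dots>, q\<close>, that is, for the connected
  subgraph \<open>[p, q - 1]\<close>.  The quotient \<open>T p M (T p (M - 1))\<^sup>-\<^sup>1\<close> is the loop of strand \<open>M\<close> around
  the strands \<open>p, \<dots>, M - 1\<close>.  In the presence of (1), the relations (2) say how the twists on the
  first \<open>M - 1\<close> strands act on these loops by conjugation, and this action preserves the
  subgroup generated by the loops.  So every element of the presented group is a product of a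
  loop element and an element of the same group for \<open>M - 1\<close> strands; the analogous coset
  enumeration in the braid group shows that the twists generate the pure braid group.

  For injectivity no knowledge of free groups is needed: the braid group acts by the Hurwitz
  moves on sequences of elements of the free racks over any group, in particular over the
  presented group itself.  If strand \<open>M\<close> carries a trivial label, the other strands do not see
  it, and for a suitable labelling of these the loop element can be read off from strand \<open>M\<close>.
  Induction on \<open>M\<close> then shows that the presented group acts faithfully.
\<close>

section \<open>Commuting elements\<close>

text \<open>Relation (2) does not look like a statement about conjugation. Given its instance for M
  - 1, the instance for M becomes one: \<open>inv (t i c) \<otimes> (t i b \<otimes> t a c)\<close>
  commutes with \<open>loop M a \<otimes> inv (loop M (Suc b))\<close>. The degenerate instance c =
  M is not among the relations (2); it follows from (1) and is where induction on M can start. The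
  three twists are then separated by attaching to each the loop quotient that compensates its
  action. This compensation comes from the braid group: when strand M is brought back next to strand
  q, the twist on p, ..., q times the loop quotient becomes the full twist on one strand more, which
  is central in the braids on those strands. The resulting equivalence is used in both directions:
  in the braid group the action is computed and (2) follows, in the presented group (2) is given and
  the action follows. This is why both groups are made instances of
  \<open>twists_base\<close>.\<close>

context group
begin

lemma mult_inv_cancel [simp]:
  assumes "x \<in> carrier G" "y \<in> carrier G"
  shows "x \<otimes> (inv x \<otimes> y) = y" "inv x \<otimes> (x \<otimes> y) = y"
  using assms by (simp_all flip: m_assoc)

definition commute :: "'a \<Rightarrow> 'a \<Rightarrow> bool" where
  "commute x y \<longleftrightarrow> x \<in> carrier G \<and> y \<in> carrier G \<and> x \<otimes> y = y \<otimes> x"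

lemma commuteD:
  assumes "commute x y"
  shows "x \<in> carrier G" "y \<in> carrier G" "x \<otimes> y = y \<otimes> x"
  using assms by (auto simp: commute_def)

lemma commute_sym: "commute x y \<Longrightarrow> commute y x"
  by (auto simp: commute_def)

lemma commute_refl: "x \<in> carrier G \<Longrightarrow> commute x x"
  by (auto simp: commute_def)

lemma commute_one: "x \<in> carrier G \<Longrightarrow> commute \<one> x"
  by (auto simp: commute_def)

lemma commute_left:
  assumes "commute x y" "z \<in> carrier G"
  shows "x \<otimes> (y \<otimes> z) = y \<otimes> (x \<otimes> z)"
  using assms by (auto simp: commute_def simp flip: m_assoc)

lemma commute_mult:
  assumes "commute x z" "commute y z"
  shows "commute (x \<otimes> y) z"
proof -
  have "x \<otimes> y \<otimes> z = x \<otimes> (z \<otimes> y)" using assms by (simp add: commute_def m_assoc)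
  also have "\<dots> = z \<otimes> (x \<otimes> y)" using assms(2) commute_left[OF assms(1)] by (simp add: commute_def)
  finally show ?thesis using assms by (simp add: commute_def)
qed

lemma commute_inv:
  assumes "commute x z"
  shows "commute (inv x) z"
proof -
  have "inv x \<otimes> z = inv x \<otimes> (z \<otimes> x \<otimes> inv x)"
    using assms by (simp add: commute_def m_assoc)
  also have "\<dots> = inv x \<otimes> (x \<otimes> z \<otimes> inv x)"
    using assms by (simp add: commute_def)
  also have "\<dots> = z \<otimes> inv x"
    using commuteD(1,2)[OF assms] by (simp add: m_assoc)
  finally show ?thesis using assms by (simp add: commute_def)
qed

lemma commute_mult_right: "commute z x \<Longrightarrow> commute z y \<Longrightarrow> commute z (x \<otimes> y)"
  by (rule commute_sym, rule commute_mult; erule commute_sym)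

lemma commute_inv_right: "commute z x \<Longrightarrow> commute z (inv x)"
  by (rule commute_sym, rule commute_inv, erule commute_sym)

lemma commute_conj:
  assumes "commute x y" "c \<in> carrier G"
  shows "commute (c \<otimes> x \<otimes> inv c) (c \<otimes> y \<otimes> inv c)"
  using assms commute_left[OF assms(1)] by (simp add: commute_def m_assoc)

end

section \<open>Full twists in the braid group\<close>

text \<open>There are two instances: the braid group, with trivial generators outside 1, ..., N - 1,
  and the Hurwitz moves. A trivial generator commutes with everything, so far commutation carries no
  bounds; the braid relation would fail at the edge of the range and keeps them.\<close>

locale braid = group G for G (structure) +
  fixes s :: "nat \<Rightarrow> 'a" and N :: nat
  assumes s_closed [simp]: "s i \<in> carrier G"
    and s_far: "i + 2 \<le> j \<Longrightarrow> s i \<otimes> s j = s j \<otimes> s i"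
    and s_braid: "1 \<le> i \<Longrightarrow> i + 1 < N \<Longrightarrow>
      s i \<otimes> (s (i + 1) \<otimes> s i) = s (i + 1) \<otimes> (s i \<otimes> s (i + 1))"
begin

lemma commute_s: "i + 2 \<le> j \<or> j + 2 \<le> i \<Longrightarrow> commute (s i) (s j)"
  using s_far by (auto simp: commute_def)

text \<open>All the words below are indexed by strands \<open>p \<le> q\<close> and not by nodes: the interval
  \<open>[i, j]\<close> of nodes is the interval \<open>[i, j + 1]\<close> of strands.\<close>

primrec dn :: "nat \<Rightarrow> nat \<Rightarrow> 'a" where
  "dn p 0 = \<one>"
| "dn p (Suc q) = (if p \<le> q then s q \<otimes> dn p q else \<one>)"

primrec up :: "nat \<Rightarrow> nat \<Rightarrow> 'a" where
  "up p 0 = \<one>"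
| "up p (Suc q) = (if p \<le> q then up p q \<otimes> s q else \<one>)"

text \<open>The word s(q-1) ... s(p) s(p) ... s(q-1): strand q runs once around the strands p, ...,
  q - 1.\<close>

definition X :: "nat \<Rightarrow> nat \<Rightarrow> 'a" where
  "X p q = dn p q \<otimes> up p q"

primrec L :: "nat \<Rightarrow> nat \<Rightarrow> 'a" where
  "L p 0 = \<one>"
| "L p (Suc q) = (if p \<le> q then L p q \<otimes> dn p (Suc q) else \<one>)"

text \<open>A product of the loops \<open>X p r\<close> and not a square, because this recursion in
  q fits the inductions; \<open>L_square\<close> identifies it with the square of the half twist
  \<open>L\<close>.\<close>

primrec T :: "nat \<Rightarrow> nat \<Rightarrow> 'a" where
  "T p 0 = \<one>"
| "T p (Suc q) = (if p \<le> q then T p q \<otimes> X p (Suc q) else \<one>)"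

lemma dn_closed [simp]: "dn p q \<in> carrier G" by (induction q) auto
lemma up_closed [simp]: "up p q \<in> carrier G" by (induction q) auto
lemma X_closed [simp]: "X p q \<in> carrier G" by (simp add: X_def)
lemma L_closed [simp]: "L p q \<in> carrier G" by (induction q) auto
lemma T_closed [simp]: "T p q \<in> carrier G" by (induction q) auto

lemma trivial [simp]:
  assumes "q \<le> p"
  shows "dn p q = \<one>" "up p q = \<one>" "X p q = \<one>" "L p q = \<one>" "T p q = \<one>"
  using assms by (cases q; simp add: X_def)+

lemma dn_left: "p < q \<Longrightarrow> dn p q = dn (Suc p) q \<otimes> s p"
proof (induction q)
  case (Suc q)
  then show ?case by (cases "p = q") (auto simp: m_assoc)
qed simp

lemma up_left: "p < q \<Longrightarrow> up p q = s p \<otimes> up (Suc p) q"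
proof (induction q)
  case (Suc q)
  then show ?case by (cases "p = q") (auto simp: m_assoc)
qed simp

text \<open>Serves with centralizers, which gives \<open>commute_word\<close>, and later with the
  permutations that ignore one strand.\<close>

lemma mem_subgroup:
  assumes "subgroup H G" "\<And>i. p \<le> i \<Longrightarrow> i < q \<Longrightarrow> s i \<in> H"
  shows "dn p q \<in> H" "up p q \<in> H" "X p q \<in> H" "T p q \<in> H"
proof -
  have 1: "(\<And>i. p \<le> i \<Longrightarrow> i < q \<Longrightarrow> s i \<in> H) \<Longrightarrow> dn p q \<in> H \<and> up p q \<in> H" for q
    by (induction q) (auto intro: subgroup.m_closed[OF assms(1)] subgroup.one_closed[OF assms(1)])
  then have 2: "(\<And>i. p \<le> i \<Longrightarrow> i < q \<Longrightarrow> s i \<in> H) \<Longrightarrow> X p q \<in> H" for q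
    by (auto simp: X_def intro: subgroup.m_closed[OF assms(1)])
  have "(\<And>i. p \<le> i \<Longrightarrow> i < q \<Longrightarrow> s i \<in> H) \<Longrightarrow> T p q \<in> H" for q
    by (induction q)
      (auto intro!: 2 subgroup.m_closed[OF assms(1)] subgroup.one_closed[OF assms(1)])
  with 1 2 assms(2) show "dn p q \<in> H" "up p q \<in> H" "X p q \<in> H" "T p q \<in> H"
    by blast+
qed

lemma subgroup_centralizer: "z \<in> carrier G \<Longrightarrow> subgroup {x. commute x z} G"
  by (rule subgroupI)
    (auto intro: commute_mult commute_inv commute_one simp: commuteD)

lemma commute_word:
  assumes "z \<in> carrier G" "\<And>i. p \<le> i \<Longrightarrow> i < q \<Longrightarrow> commute (s i) z"
  shows "commute (dn p q) z" "commute (up p q) z" "commute (X p q) z" "commute (T p q) z"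
  using mem_subgroup[OF subgroup_centralizer[OF assms(1)]] assms(2) by auto

lemma commute_s_word:
  assumes "i + 1 < p \<or> q < i"
  shows "commute (dn p q) (s i)" "commute (up p q) (s i)" "commute (X p q) (s i)" "commute (T p q) (s i)"
  by (rule commute_word[of "s i"]; use assms in \<open>auto intro!: commute_s\<close>)+

text \<open>Once \<open>s m\<close> has passed the letters below m - 1, the braid relation for m - 1
  and m turns it into \<open>s (m - 1)\<close>, which commutes with all letters above m.\<close>

lemma dn_s:
  assumes "1 \<le> p" "p < m" "m < q" "q \<le> N"
  shows "dn p q \<otimes> s m = s (m - 1) \<otimes> dn p q"
  using assms
proof (induction q)
  case (Suc q)
  show ?case
  proof (cases "m = q")
    case False
    then have IH: "dn p q \<otimes> s m = s (m - 1) \<otimes> dn p q" using Suc by auto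
    have c: "s q \<otimes> s (m - 1) = s (m - 1) \<otimes> s q"
      using commute_s[of q "m - 1"] Suc.prems False by (auto simp: commute_def)
    have "dn p (Suc q) \<otimes> s m = s q \<otimes> (s (m - 1) \<otimes> dn p q)"
      using Suc.prems IH by (simp add: m_assoc)
    also have "\<dots> = s (m - 1) \<otimes> (s q \<otimes> dn p q)"
      using c by (simp flip: m_assoc)
    finally show ?thesis using Suc.prems by simp
  next
    case True
    then obtain k where k: "q = Suc k" "p \<le> k" "1 \<le> k" "m = Suc k"
      using Suc.prems by (cases q) auto
    have c: "dn p k \<otimes> s (Suc k) = s (Suc k) \<otimes> dn p k"
      using commute_s_word(1)[of "Suc k" p k] by (simp add: commute_def)
    have "dn p (Suc q) \<otimes> s m = s (Suc k) \<otimes> (s k \<otimes> (dn p k \<otimes> s (Suc k)))"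
      using k by (simp add: m_assoc)
    also have "\<dots> = (s (Suc k) \<otimes> (s k \<otimes> s (Suc k))) \<otimes> dn p k"
      by (simp add: c m_assoc)
    also have "\<dots> = (s k \<otimes> (s (Suc k) \<otimes> s k)) \<otimes> dn p k"
      using s_braid[of k] k Suc.prems by simp
    finally show ?thesis using k by (simp add: m_assoc)
  qed
qed simp

lemma s_up:
  assumes "1 \<le> p" "p < m" "m < q" "q \<le> N"
  shows "s m \<otimes> up p q = up p q \<otimes> s (m - 1)"
  using assms
proof (induction q)
  case (Suc q)
  show ?case
  proof (cases "m = q")
    case False
    then have IH: "s m \<otimes> up p q = up p q \<otimes> s (m - 1)" using Suc by auto
    have c: "s q \<otimes> s (m - 1) = s (m - 1) \<otimes> s q"
      using commute_s[of q "m - 1"] Suc.prems False by (auto simp: commute_def)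
    have "s m \<otimes> up p (Suc q) = up p q \<otimes> s (m - 1) \<otimes> s q"
      using Suc.prems IH by (simp flip: m_assoc)
    also have "\<dots> = up p q \<otimes> s q \<otimes> s (m - 1)"
      using c by (simp add: m_assoc)
    finally show ?thesis using Suc.prems by simp
  next
    case True
    then obtain k where k: "q = Suc k" "p \<le> k" "1 \<le> k" "m = Suc k"
      using Suc.prems by (cases q) auto
    have c: "s (Suc k) \<otimes> up p k = up p k \<otimes> s (Suc k)"
      using commute_s_word(2)[of "Suc k" p k] by (simp add: commute_def)
    have "s m \<otimes> up p (Suc q) = s (Suc k) \<otimes> up p k \<otimes> s k \<otimes> s (Suc k)"
      using k by (simp add: m_assoc)
    also have "\<dots> = up p k \<otimes> (s (Suc k) \<otimes> (s k \<otimes> s (Suc k)))"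
      by (simp add: c m_assoc)
    also have "\<dots> = up p k \<otimes> (s k \<otimes> (s (Suc k) \<otimes> s k))"
      using s_braid[of k] k Suc.prems by simp
    finally show ?thesis using k by (simp add: m_assoc)
  qed
qed simp

text \<open>Moving right through \<open>dn\<close>, the index m rises to m + 1; through
  \<open>up\<close> it falls back to m.\<close>

lemma commute_s_X:
  assumes "1 \<le> p" "p \<le> m" "m + 1 < q" "q \<le> N"
  shows "commute (s m) (X p q)"
proof -
  have 1: "dn p q \<otimes> s (Suc m) = s m \<otimes> dn p q"
    using dn_s[of p "Suc m" q] assms by simp
  have 2: "s (Suc m) \<otimes> up p q = up p q \<otimes> s m"
    using s_up[of p "Suc m" q] assms by simp
  have "s m \<otimes> X p q = dn p q \<otimes> (s (Suc m) \<otimes> up p q)"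
    by (simp add: X_def 1 flip: m_assoc)
  also have "\<dots> = X p q \<otimes> s m"
    by (simp add: X_def 2 m_assoc)
  finally show ?thesis by (simp add: commute_def)
qed

lemma X_Suc: "p \<le> q \<Longrightarrow> X p (Suc q) = s q \<otimes> X p q \<otimes> s q"
  by (simp add: X_def m_assoc)

text \<open>Centrality of the full twist. In the induction the older generators commute with the new
  factor by \<open>commute_s_X\<close>; only the newest generator needs an argument of its
  own.\<close>

lemma commute_s_T:
  assumes "1 \<le> p" "p \<le> m" "m < q" "q \<le> N"
  shows "commute (s m) (T p q)"
  using assms
proof (induction q)
  case (Suc q)
  show ?case
  proof (cases "m = q")
    case False
    then show ?thesis using Suc by (auto intro!: commute_mult_right commute_s_X)
  next
    case True
    show ?thesis
    proof (cases "p = q")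
      case True
      then show ?thesis using \<open>m = q\<close> by (simp add: X_def commute_def m_assoc)
    next
      case False
      then obtain k where k: "q = Suc k" "p \<le> k" using Suc.prems True by (cases q) auto
      define x where "x = X p q"
      have x: "x \<in> carrier G" by (simp add: x_def)
      have X: "X p (Suc q) = s q \<otimes> (x \<otimes> s q)"
        using Suc.prems True by (simp add: X_Suc x_def m_assoc)
      \<comment> \<open>With s for \<open>s q\<close> this reads x s x s = s x s x, the braid
        relation of type B. It makes s commute with x s x s, which is
        \<open>x \<otimes> X p (Suc q)\<close>.\<close>
      have "commute x (X p (Suc q))"
        unfolding x_def using Suc.prems by (intro commute_word(3)) (auto intro!: commute_s_X)
      then have e: "x \<otimes> (s q \<otimes> (x \<otimes> s q)) = s q \<otimes> (x \<otimes> (s q \<otimes> x))"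
        using x by (simp add: X commute_def m_assoc)
      have "s q \<otimes> (x \<otimes> X p (Suc q)) = (s q \<otimes> (x \<otimes> (s q \<otimes> x))) \<otimes> s q"
        using x by (simp add: X m_assoc)
      also have "\<dots> = x \<otimes> X p (Suc q) \<otimes> s q"
        using x by (simp add: X m_assoc flip: e)
      finally have "commute (s q) (x \<otimes> X p (Suc q))" using x by (simp add: commute_def m_assoc)
      moreover have "T p (Suc q) = T p k \<otimes> (x \<otimes> X p (Suc q))"
        using k by (simp add: x_def m_assoc)
      moreover have "commute (s q) (T p k)"
        using k by (auto intro!: commute_sym[OF commute_s_word(4)])
      ultimately show ?thesis using True by (auto intro: commute_mult_right)
    qed
  qed
qed simp

text \<open>The case m = p of \<open>L_s\<close>, out of reach of \<open>dn_s\<close>, which needs p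
  < m. Two descending words must be handled together here, since a single one does not move
  \<open>s p\<close> past itself.\<close>

lemma L_s_first:
  assumes "1 \<le> p" "p < q" "q \<le> N"
  shows "L p q \<otimes> s p = s (q - 1) \<otimes> L p q"
proof -
  obtain k where k: "q = Suc k" "p \<le> k" using assms by (cases q) auto
  show ?thesis
  proof (cases "p = k")
    case True
    then show ?thesis using k by simp
  next
    case False
    then obtain l where l: "k = Suc l" "p \<le> l" using k by (cases k) auto
    \<comment> \<open>\<open>dn p q\<close> lowers each letter of the shifted descending word by
      one. For r = q this rewrites the square of \<open>dn p q\<close>.\<close>
    have "dn p q \<otimes> dn (Suc p) r = dn p (r - 1) \<otimes> dn p q" if "r \<le> q" for r
      using that
    proof (induction r)
      case (Suc r)
      show ?case
      proof (cases "p < r")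
        case True
        then obtain r' where r': "r = Suc r'" by (cases r) auto
        have "dn p q \<otimes> dn (Suc p) (Suc r) = dn p q \<otimes> s r \<otimes> dn (Suc p) r"
          using True by (simp add: m_assoc)
        also have "\<dots> = s (r - 1) \<otimes> dn p (r - 1) \<otimes> dn p q"
          using True Suc assms by (simp add: dn_s m_assoc)
        finally show ?thesis using True r' by simp
      qed simp
    qed simp
    from this[of q] have "dn p q \<otimes> dn p q = dn p k \<otimes> dn p q \<otimes> s p"
      using dn_left[of p q] assms k by (simp add: m_assoc del: dn.simps flip: m_assoc)
    then have e: "dn p k \<otimes> (dn p q \<otimes> s p) = s k \<otimes> (dn p k \<otimes> dn p q)"
      using k by (simp add: m_assoc)
    have L: "L p q = L p l \<otimes> (dn p k \<otimes> dn p q)"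
      using k l by (simp add: m_assoc)
    have "subgroup H G \<Longrightarrow> (\<And>i. p \<le> i \<Longrightarrow> i < r \<Longrightarrow> s i \<in> H) \<Longrightarrow> L p r \<in> H" for H r
      by (induction r) (auto intro!: mem_subgroup subgroup.m_closed subgroup.one_closed)
    from this[OF subgroup_centralizer[of "s k"], of l] have c: "commute (L p l) (s k)"
      using l by (simp add: commute_s)
    have "L p q \<otimes> s p = L p l \<otimes> (s k \<otimes> (dn p k \<otimes> dn p q))"
      by (simp add: L m_assoc e del: dn.simps)
    also have "\<dots> = s k \<otimes> L p q"
      unfolding L using commute_left[OF c] by simp
    finally show ?thesis using k by simp
  qed
qed

text \<open>Conjugation by the half twist is the reflection of the Dynkin graph: the last factor
  lowers m by one, and the shorter half twist then reflects a shorter interval.\<close>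

lemma L_s:
  assumes "1 \<le> p" "p \<le> m" "m < q" "q \<le> N"
  shows "L p q \<otimes> s m = s (p + q - 1 - m) \<otimes> L p q"
  using assms
proof (induction q arbitrary: m)
  case (Suc q)
  show ?case
  proof (cases "m = p")
    case True
    then show ?thesis using L_s_first[of p "Suc q"] Suc.prems by simp
  next
    case False
    have "L p (Suc q) \<otimes> s m = L p q \<otimes> s (m - 1) \<otimes> dn p (Suc q)"
      using dn_s[of p m "Suc q"] Suc.prems False by (simp add: m_assoc del: dn.simps)
    also have "\<dots> = s (p + q - 1 - (m - 1)) \<otimes> L p q \<otimes> dn p (Suc q)"
      using Suc.IH[of "m - 1"] Suc.prems False by simp
    also have "p + q - 1 - (m - 1) = p + Suc q - 1 - m"
      using False Suc.prems by simp
    finally show ?thesis using False Suc.prems by (simp add: m_assoc del: dn.simps)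
  qed
qed simp

lemma L_up:
  assumes "1 \<le> p" "q \<le> N"
  shows "L p q \<otimes> up p q = dn p q \<otimes> L p q"
proof (cases "p \<le> q")
  case True
  have "L p q \<otimes> up p r = dn (p + q - r) q \<otimes> L p q" if "p \<le> r" "r \<le> q" for r
    using that
  proof (induction r)
    case (Suc r)
    show ?case
    proof (cases "p = Suc r")
      case False
      have "L p q \<otimes> up p (Suc r) = dn (p + q - r) q \<otimes> (L p q \<otimes> s r)"
        using Suc.IH Suc.prems False by (simp flip: m_assoc)
      also have "L p q \<otimes> s r = s (p + q - Suc r) \<otimes> L p q"
        using L_s[of p r q] Suc False assms by simp
      also have "p + q - r = Suc (p + q - Suc r)" using Suc.prems by simp
      finally show ?thesis using dn_left[of "p + q - Suc r" q] Suc.prems False by (simp add: m_assoc)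
    qed simp
  qed (use assms in simp)
  from this[of q] True show ?thesis by simp
qed simp

text \<open>By \<open>L_up\<close> the last descending factor of the left copy crosses the right
  copy and becomes ascending; next to the last descending factor of the right copy it forms
  \<open>X p (Suc q)\<close>.\<close>

lemma L_square: "1 \<le> p \<Longrightarrow> q \<le> N \<Longrightarrow> L p q \<otimes> L p q = T p q"
proof (induction q)
  case (Suc q)
  show ?case
  proof (cases "p \<le> q")
    case True
    have "L p (Suc q) \<otimes> L p (Suc q) = L p q \<otimes> (dn p (Suc q) \<otimes> L p (Suc q))"
      using True by (simp add: m_assoc)
    also have "\<dots> = L p q \<otimes> (L p (Suc q) \<otimes> up p (Suc q))"
      using L_up[of p "Suc q"] Suc.prems by simp
    also have "\<dots> = L p q \<otimes> L p q \<otimes> X p (Suc q)"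
      using True by (simp add: m_assoc X_def)
    finally show ?thesis using True Suc by simp
  qed simp
qed simp

end

section \<open>Commutation of full twists and the relation (2)\<close>

text \<open>Relations (1) alone, in a form shared by the braid group and the presented group.
  Strands p, ..., q stand for nodes p, ..., q - 1, so node distance at least 2 means q < r. For q
  \<le> p there is no node and the twist is trivial.\<close>

locale twists_base = group G for G (structure) +
  fixes t :: "nat \<Rightarrow> nat \<Rightarrow> 'a" and N :: nat
  assumes t_closed [simp]: "t p q \<in> carrier G"
    and t_trivial [simp]: "q \<le> p \<Longrightarrow> t p q = \<one>"
    and t_far: "q < r \<Longrightarrow> commute (t p q) (t r u)"
    and t_nested: "1 \<le> p \<Longrightarrow> p \<le> r \<Longrightarrow> u \<le> q \<Longrightarrow> q \<le> N \<Longrightarrow> commute (t p q) (t r u)"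
begin

lemma t_nested': "1 \<le> p \<Longrightarrow> p \<le> r \<Longrightarrow> u \<le> q \<Longrightarrow> q \<le> N \<Longrightarrow> commute (t r u) (t p q)"
  by (rule commute_sym[OF t_nested])

lemma t_far': "q < r \<Longrightarrow> commute (t r u) (t p q)"
  by (rule commute_sym[OF t_far])

text \<open>In the braid group this is strand \<open>M\<close> running around the strands \<open>p, \<dots>, M - 1\<close>.\<close>

definition loop :: "nat \<Rightarrow> nat \<Rightarrow> 'a" where
  "loop M p = t p M \<otimes> inv (t p (M - 1))"

text \<open>Relation (2) for the node intervals A = [i, b - 1], B = [a, c - 1], C = [b + 1, M - 1].
  The node between A and C is b, and the unions are [i, c - 1] and [a, M - 1].\<close>

definition lantern :: "nat \<Rightarrow> nat \<Rightarrow> nat \<Rightarrow> nat \<Rightarrow> nat \<Rightarrow> bool" where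
  "lantern i a b c M \<longleftrightarrow>
     inv (t i c) \<otimes> (t i b \<otimes> (t a c \<otimes> (t (Suc b) M \<otimes> inv (t a M))))
   = inv (t a M) \<otimes> (t (Suc b) M \<otimes> (t a c \<otimes> (t i b \<otimes> inv (t i c))))"

text \<open>The twist \<open>t p q\<close> conjugates the loops of strand \<open>M\<close> around strands between \<open>p\<close> and \<open>q\<close>
  in the same way as the inverse of the loop around all of these strands.\<close>

definition twist_action :: "nat \<Rightarrow> nat \<Rightarrow> nat \<Rightarrow> nat \<Rightarrow> bool" where
  "twist_action M p r q \<longleftrightarrow>
     commute (t p q \<otimes> (loop M p \<otimes> inv (loop M (Suc q)))) (loop M r \<otimes> inv (loop M (Suc q)))"

lemma loop_closed [simp]: "loop M p \<in> carrier G" by (simp add: loop_def)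

lemma loop_trivial [simp]: "M \<le> p \<Longrightarrow> loop M p = \<one>" by (simp add: loop_def)

lemma t_eq: "t p M = loop M p \<otimes> t p (M - 1)"
  by (simp add: loop_def m_assoc)

lemma commute_t_loop:
  assumes "1 \<le> p" "r \<le> p \<or> q < r" "1 \<le> r" "q < M" "M \<le> N"
  shows "commute (t p q) (loop M r)"
proof (cases "q < r")
  case True
  then show ?thesis
    unfolding loop_def by (intro commute_mult_right commute_inv_right t_far)
next
  case False
  then show ?thesis
    unfolding loop_def using assms by (intro commute_mult_right commute_inv_right t_nested') auto
qed

lemma commute_top_loop:
  assumes "1 \<le> p" "p \<le> r" "M \<le> N"
  shows "commute (t p M) (loop M r)"
  unfolding loop_def using assms by (intro commute_mult_right commute_inv_right t_nested) auto

lemma commute_sub_loop: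
  assumes "1 \<le> r" "r \<le> p" "M \<le> N"
  shows "commute (t p (M - 1)) (loop M r)"
  unfolding loop_def using assms by (intro commute_mult_right commute_inv_right t_nested') auto

text \<open>For q = M - 1 the loop \<open>loop M (Suc q)\<close> is trivial and the compensated
  twist is \<open>t p M\<close>, which commutes with the loops inside it by (1).\<close>

lemma twist_action_last:
  assumes "1 \<le> p" "p < r" "Suc q = M" "M \<le> N"
  shows "twist_action M p r q"
proof -
  have "t p q \<otimes> loop M p = t p M"
    using commute_sub_loop[of p p M] t_eq[of p M] assms by (auto simp: commute_def)
  then show ?thesis
    using commute_top_loop[of p r M] assms by (simp add: twist_action_def)
qed

text \<open>The twist of B and that of the union of B and C coincide here and cancel across the
  nested \<open>t (Suc b) c\<close>; the remaining equality is an instance of (1).\<close>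

lemma lantern_last:
  assumes "1 \<le> i" "i < a" "a \<le> b" "b < c" "c \<le> N"
  shows "lantern i a b c c"
proof -
  let ?A = "t i b" and ?B = "t a c" and ?C = "t (Suc b) c" and ?D = "t i c"
  have c: "commute ?B ?C" "commute ?C ?A" "commute (inv ?D) ?A" "commute (inv ?D) ?C"
    using assms by (simp_all add: t_nested t_far' commute_inv)
  have "inv ?D \<otimes> (?A \<otimes> (?B \<otimes> (?C \<otimes> inv ?B))) = inv ?D \<otimes> (?A \<otimes> ?C)"
    using commute_left[OF c(1), of "inv ?B"] by simp
  moreover have "inv ?B \<otimes> (?C \<otimes> (?B \<otimes> (?A \<otimes> inv ?D))) = ?C \<otimes> (?A \<otimes> inv ?D)"
    using commute_left[OF commute_sym[OF c(1)], of "?A \<otimes> inv ?D"] by simp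
  moreover have "?C \<otimes> (?A \<otimes> inv ?D) = inv ?D \<otimes> (?A \<otimes> ?C)"
  proof -
    have "?C \<otimes> (?A \<otimes> inv ?D) = (?A \<otimes> ?C) \<otimes> inv ?D"
      using commuteD(3)[OF c(2)] by (simp flip: m_assoc)
    also have "\<dots> = inv ?D \<otimes> (?A \<otimes> ?C)"
      using commute_mult_right[OF c(3,4)] by (simp add: commute_def)
    finally show ?thesis .
  qed
  ultimately show ?thesis by (simp add: lantern_def)
qed

text \<open>Splitting \<open>t a M\<close> and \<open>t (Suc b) M\<close> into a loop and a shorter
  twist inserts \<open>inv z\<close> into the instance for M - 1: to the right of h on one side of
  the equation, to the left of h on the other.\<close>

lemma lantern_step:
  assumes "1 \<le> i" "i < a" "a \<le> b" "b < c" "c < M" "M \<le> N"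
    and prev: "lantern i a b c (M - 1)"
  shows "lantern i a b c M \<longleftrightarrow>
    commute (inv (t i c) \<otimes> (t i b \<otimes> t a c)) (loop M a \<otimes> inv (loop M (Suc b)))"
proof -
  define h where "h = inv (t i c) \<otimes> (t i b \<otimes> t a c)"
  define h' where "h' = t a c \<otimes> (t i b \<otimes> inv (t i c))"
  define z where "z = loop M a \<otimes> inv (loop M (Suc b))"
  define e where "e = t a (M - 1)"
  define d where "d = t (Suc b) (M - 1)"
  let ?x = "loop M (Suc b)" and ?y = "loop M a"
  have cl [simp]: "h \<in> carrier G" "h' \<in> carrier G" "z \<in> carrier G" "e \<in> carrier G" "d \<in> carrier G"
    by (simp_all add: h_def h'_def z_def e_def d_def)
  have tM: "t a M = ?y \<otimes> e" "t (Suc b) M = ?x \<otimes> d"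
    by (simp_all add: e_def d_def t_eq[of _ M])
  have c: "commute d ?x" "commute d ?y" "commute d e" "commute e ?y" "commute (?y \<otimes> e) ?x"
    unfolding tM(1)[symmetric] unfolding d_def e_def using assms
    by (intro commute_sub_loop commute_top_loop t_nested'; simp)+
  have prev: "h \<otimes> (d \<otimes> inv e) = inv e \<otimes> (d \<otimes> h')"
    using prev by (simp add: lantern_def h_def h'_def d_def e_def m_assoc)
  have zz: "inv (?y \<otimes> e) \<otimes> ?x = inv z \<otimes> inv e"
    using commuteD(3)[OF commute_inv[OF c(5)]]  commuteD(3)[OF commute_inv[OF commute_inv_right[OF c(4)]]]
    by (simp add: z_def inv_mult_group m_assoc)
  have l: "inv (t i c) \<otimes> (t i b \<otimes> (t a c \<otimes> (t (Suc b) M \<otimes> inv (t a M))))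
      = h \<otimes> (inv z \<otimes> (d \<otimes> inv e))"
  proof -
    have "inv (t i c) \<otimes> (t i b \<otimes> (t a c \<otimes> (t (Suc b) M \<otimes> inv (t a M))))
       = h \<otimes> (?x \<otimes> d \<otimes> inv (?y \<otimes> e))"
      by (simp add: h_def tM m_assoc)
    also have "?x \<otimes> d \<otimes> inv (?y \<otimes> e) = ?x \<otimes> inv (?y \<otimes> e) \<otimes> d"
    proof -
      have "commute d (inv (?y \<otimes> e))"
        using c by (intro commute_inv_right commute_mult_right)
      then show ?thesis using commuteD(3)[of d "inv (?y \<otimes> e)"] by (simp add: m_assoc)
    qed
    also have "?x \<otimes> inv (?y \<otimes> e) = inv (?y \<otimes> e) \<otimes> ?x"
      using commuteD(3)[OF commute_inv[OF c(5)]] by simp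
    also have "\<dots> \<otimes> d = inv z \<otimes> (d \<otimes> inv e)"
      unfolding zz using commuteD(3)[OF commute_inv_right[OF c(3)]] by (simp add: m_assoc)
    finally show ?thesis .
  qed
  have r: "inv (t a M) \<otimes> (t (Suc b) M \<otimes> (t a c \<otimes> (t i b \<otimes> inv (t i c))))
     = inv z \<otimes> (h \<otimes> (d \<otimes> inv e))"
  proof -
    have "inv (t a M) \<otimes> (t (Suc b) M \<otimes> (t a c \<otimes> (t i b \<otimes> inv (t i c))))
       = inv (?y \<otimes> e) \<otimes> ?x \<otimes> (d \<otimes> h')"
      by (simp add: h'_def tM m_assoc)
    then show ?thesis by (simp add: zz prev m_assoc)
  qed
  have "lantern i a b c M \<longleftrightarrow> h \<otimes> inv z \<otimes> (d \<otimes> inv e) = inv z \<otimes> h \<otimes> (d \<otimes> inv e)"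
    unfolding lantern_def l r by (simp add: m_assoc)
  also have "\<dots> \<longleftrightarrow> commute h (inv z)"
    by (simp add: commute_def)
  also have "\<dots> \<longleftrightarrow> commute h z"
    using commute_inv_right[of h z] commute_inv_right[of h "inv z"] by auto
  finally show ?thesis by (simp add: h_def z_def)
qed

text \<open>All factors on the right except \<open>t i b \<otimes> w\<close> commute with \<open>loop M a \<otimes> inv (loop M (Suc b))\<close> as soon as
  the actions of \<open>t i c\<close> and \<open>t a c\<close> are known.\<close>

lemma lantern_factor:
  assumes "1 \<le> i" "i < a" "a \<le> b" "b < c" "c < M" "M \<le> N"
  shows "inv (t i c) \<otimes> (t i b \<otimes> t a c) =
    inv (t i c \<otimes> (loop M i \<otimes> inv (loop M (Suc c)))) \<otimes>
      (t i b \<otimes> (loop M i \<otimes> inv (loop M (Suc b))) \<otimes>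
        (inv (loop M a \<otimes> inv (loop M (Suc b))) \<otimes>
          (t a c \<otimes> (loop M a \<otimes> inv (loop M (Suc c))))))"
proof -
  define A B D where "A = t i b" and "B = t a c" and "D = t i c"
  define wA wB wD r where "wA = loop M i \<otimes> inv (loop M (Suc b))"
    and "wB = loop M a \<otimes> inv (loop M (Suc c))" and "wD = loop M i \<otimes> inv (loop M (Suc c))"
    and "r = loop M (Suc b) \<otimes> inv (loop M (Suc c))"
  have cl [simp]: "A \<in> carrier G" "B \<in> carrier G" "D \<in> carrier G" "wA \<in> carrier G"
    "wB \<in> carrier G" "wD \<in> carrier G" "r \<in> carrier G"
    by (simp_all add: A_def B_def D_def wA_def wB_def wD_def r_def)
  have c: "commute D wD" "commute A wA" "commute B wB" "commute A r"
    unfolding A_def B_def D_def wA_def wB_def wD_def r_def using assms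
    by (auto intro!: commute_mult_right commute_inv_right commute_t_loop)
  have wD: "wD = wA \<otimes> r" by (simp add: wA_def wD_def r_def m_assoc)
  have z: "inv (loop M a \<otimes> inv (loop M (Suc b))) = r \<otimes> inv wB"
    by (simp add: r_def wB_def m_assoc inv_mult_group)
  have "inv (D \<otimes> wD) \<otimes> (A \<otimes> wA \<otimes> (r \<otimes> inv wB \<otimes> (B \<otimes> wB)))
     = inv D \<otimes> inv wD \<otimes> (A \<otimes> wA \<otimes> (r \<otimes> inv wB \<otimes> (wB \<otimes> B)))"
    using commuteD(3)[OF c(1)] commuteD(3)[OF c(3)] by (simp add: inv_mult_group)
  also have "\<dots> = inv D \<otimes> inv wD \<otimes> (wA \<otimes> A \<otimes> (r \<otimes> B))"
    using commuteD(3)[OF c(2)] by (simp add: m_assoc)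
  also have "\<dots> = inv D \<otimes> inv wD \<otimes> (wA \<otimes> (r \<otimes> (A \<otimes> B)))"
    using commute_left[OF c(4)] by (simp add: m_assoc)
  also have "\<dots> = inv D \<otimes> (A \<otimes> B)"
    by (simp add: wD m_assoc inv_mult_group)
  finally show ?thesis
    by (simp add: z flip: A_def B_def D_def wA_def wB_def wD_def)
qed

lemma commute_quotient:
  assumes "commute g (a \<otimes> inv c)" "commute g (b \<otimes> inv c)"
    "a \<in> carrier G" "b \<in> carrier G" "c \<in> carrier G"
  shows "commute g (a \<otimes> inv b)"
proof -
  have "commute g ((a \<otimes> inv c) \<otimes> inv (b \<otimes> inv c))"
    by (intro commute_mult_right commute_inv_right assms)
  then show ?thesis using assms by (simp add: m_assoc inv_mult_group)
qed

lemma commute_outer_factors: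
  assumes "1 \<le> i" "i < a" "a \<le> b" "b < c" "c < M" "M \<le> N"
    and "twist_action M i a c" "twist_action M i (Suc b) c" "twist_action M a (Suc b) c"
  shows "commute (t i c \<otimes> (loop M i \<otimes> inv (loop M (Suc c)))) (loop M a \<otimes> inv (loop M (Suc b)))"
    and "commute (t a c \<otimes> (loop M a \<otimes> inv (loop M (Suc c)))) (loop M a \<otimes> inv (loop M (Suc b)))"
proof -
  show "commute (t i c \<otimes> (loop M i \<otimes> inv (loop M (Suc c)))) (loop M a \<otimes> inv (loop M (Suc b)))"
    using assms by - (rule commute_quotient[of _ "loop M a" "loop M (Suc c)"]; simp add: twist_action_def)
  \<comment> \<open>\<open>twist_action\<close> is stated for p < r, so the loop around a, ..., M -
    1 itself is treated by hand: \<open>t a c\<close> commutes with both loops of its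
    compensation.\<close>
  have "commute (t a c) (loop M a)" "commute (t a c) (loop M (Suc c))"
    using assms by (auto intro!: commute_t_loop)
  then have "commute (t a c \<otimes> (loop M a \<otimes> inv (loop M (Suc c)))) (loop M a \<otimes> inv (loop M (Suc c)))"
    by (rule commute_mult[OF commute_mult_right[OF _ commute_inv_right] commute_refl]) simp
  then show "commute (t a c \<otimes> (loop M a \<otimes> inv (loop M (Suc c)))) (loop M a \<otimes> inv (loop M (Suc b)))"
    using assms by - (rule commute_quotient[of _ "loop M a" "loop M (Suc c)"]; simp add: twist_action_def)
qed

lemma lantern_if_twist_action:
  assumes "1 \<le> i" "i < a" "a \<le> b" "b < c" "c \<le> M" "M \<le> N"
    and R: "\<And>K p r q. 1 \<le> p \<Longrightarrow> p < r \<Longrightarrow> r \<le> q \<Longrightarrow> q < K \<Longrightarrow> K \<le> M \<Longrightarrow> twist_action K p r q"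
  shows "lantern i a b c M"
  using assms(5,6,7)
proof (induction M rule: dec_induct)
  case base
  then show ?case using lantern_last assms(1-4) by auto
next
  case (step M)
  let ?z = "loop (Suc M) a \<otimes> inv (loop (Suc M) (Suc b))"
  have "lantern i a b c M" using step by auto
  moreover have "commute (inv (t i c) \<otimes> (t i b \<otimes> t a c)) ?z"
  proof -
    have "twist_action (Suc M) i a b" using step assms(1-4) by auto
    then have "commute (t i b \<otimes> (loop (Suc M) i \<otimes> inv (loop (Suc M) (Suc b)))) ?z"
      by (simp add: twist_action_def)
    moreover have "commute (inv ?z) ?z" by (simp add: commute_inv commute_refl)
    moreover have "twist_action (Suc M) i a c" "twist_action (Suc M) i (Suc b) c"
      "twist_action (Suc M) a (Suc b) c"
      using step assms(1-4) by auto
    note commute_outer_factors[OF assms(1-4) _ _ this]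
    ultimately show ?thesis
      using step.hyps step.prems assms(1-4)
      by (subst lantern_factor[of i a b c "Suc M"]) (auto intro!: commute_mult[of _ ?z] commute_inv[of _ ?z])
  qed
  ultimately show ?case using lantern_step[of i a b c "Suc M"] step.hyps step.prems assms(1-4) by simp
qed

end

section \<open>From relation (2) to the action on loops\<close>

locale twists = twists_base +
  assumes t_lantern: "1 \<le> i \<Longrightarrow> i < a \<Longrightarrow> a \<le> b \<Longrightarrow> b < c \<Longrightarrow> c < M \<Longrightarrow> M \<le> N \<Longrightarrow> lantern i a b c M"
begin

lemma twist_action_holds:
  assumes "1 \<le> p" "p < r" "r \<le> q" "q < M" "M \<le> N"
  shows "twist_action M p r q"
proof (cases "Suc q = M")
  case True
  then show ?thesis using twist_action_last assms by simp
next
  case False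
  \<comment> \<open>With c = M - 1 everything around the relation is known from (1): its instance
    for M - 1 by \<open>lantern_last\<close>, and the actions of the two outer twists by
    \<open>twist_action_last\<close>.\<close>
  define c where "c = M - 1"
  have c: "q < c" "c < M" "Suc c = M" using False assms by (auto simp: c_def)
  let ?z = "loop M r \<otimes> inv (loop M (Suc q))"
  define A' where "A' = t p q \<otimes> (loop M p \<otimes> inv (loop M (Suc q)))"
  define B' where "B' = t r c \<otimes> (loop M r \<otimes> inv (loop M (Suc c)))"
  define D' where "D' = t p c \<otimes> (loop M p \<otimes> inv (loop M (Suc c)))"
  have cl [simp]: "A' \<in> carrier G" "B' \<in> carrier G" "D' \<in> carrier G"
    by (simp_all add: A'_def B'_def D'_def)
  have "twist_action M p r c" "twist_action M p (Suc q) c" "twist_action M r (Suc q) c"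
    using assms c by (auto intro!: twist_action_last)
  note outer = commute_outer_factors[OF assms(1-3) c(1,2) assms(5) this, folded B'_def D'_def]
  have "lantern p r q c M" "lantern p r q c c"
    using assms c by (auto intro!: t_lantern lantern_last)
  then have "commute (inv (t p c) \<otimes> (t p q \<otimes> t r c)) ?z"
    using lantern_step[of p r q c M] assms c c_def by simp
  then have "commute (inv D' \<otimes> (A' \<otimes> (inv ?z \<otimes> B'))) ?z"
    using lantern_factor[of p r q c M] assms c by (simp add: A'_def B'_def D'_def)
  \<comment> \<open>Every factor except A' commutes with z and can be stripped off on either
    side.\<close>
  then have "commute (D' \<otimes> (inv D' \<otimes> (A' \<otimes> (inv ?z \<otimes> B'))) \<otimes> (inv B' \<otimes> ?z)) ?z"
    by (rule commute_mult[OF commute_mult[OF outer(1)]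
          commute_mult[OF commute_inv[OF outer(2)] commute_refl]]) simp
  then show ?thesis by (simp add: m_assoc twist_action_def flip: A'_def)
qed

end

section \<open>The full twists in the braid group satisfy (1) and (2)\<close>

context braid
begin

lemma commute_T_T_far: "q < r \<Longrightarrow> commute (T p q) (T r u)"
  by (rule commute_word) (auto intro!: commute_sym[OF commute_s_word(4)])

lemma commute_T_T_nested:
  "1 \<le> p \<Longrightarrow> p \<le> r \<Longrightarrow> u \<le> q \<Longrightarrow> q \<le> N \<Longrightarrow> commute (T p q) (T r u)"
  by (rule commute_sym, rule commute_word) (auto intro!: commute_s_T)

sublocale twists_base G T N
  by unfold_locales (auto intro: commute_T_T_far commute_T_T_nested)

lemma loop_eq_X:
  assumes "1 \<le> p" "M \<le> N"
  shows "loop M p = X p M"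
proof (cases "p < M")
  case True
  then obtain k where k: "M = Suc k" "p \<le> k" by (cases M) auto
  have "commute (T p k) (X p M)"
    using assms k by (intro commute_word) (auto intro!: commute_s_X)
  then have "T p k \<otimes> X p M \<otimes> inv (T p k) = X p M"
    by (simp add: commute_def m_assoc)
  then show ?thesis using k by (simp add: loop_def)
qed (use assms in simp)

lemma dn_split: "p \<le> k \<Longrightarrow> k \<le> q \<Longrightarrow> dn p q = dn k q \<otimes> dn p k"
proof (induction q)
  case (Suc q) then show ?case by (cases "k = Suc q") (auto simp: m_assoc)
qed simp

lemma up_split: "p \<le> k \<Longrightarrow> k \<le> q \<Longrightarrow> up p q = up p k \<otimes> up k q"
proof (induction q)
  case (Suc q) then show ?case by (cases "k = Suc q") (auto simp: m_assoc)
qed simp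

text \<open>The inner halves of the two words cancel. What remains is the loop of strand q around p,
  ..., q - 1, carried to strand M by \<open>dn q M\<close>.\<close>

lemma X_quotient:
  assumes "p \<le> q" "q \<le> M"
  shows "X p M \<otimes> inv (X q M) = dn q M \<otimes> X p q \<otimes> inv (dn q M)"
  using dn_split[OF assms] up_split[OF assms] by (simp add: X_def inv_mult_group m_assoc)

text \<open>Conjugating back by \<sigma> = \<open>dn (Suc q) M\<close> replaces strand M by strand q
  + 1. The compensated twist becomes \<open>T p (Suc q)\<close> by the recursion for
  \<open>T\<close>, and this is central among the braids on its strands.\<close>

lemma braid_twist_action:
  assumes "1 \<le> p" "p < r" "r \<le> q" "q < M" "M \<le> N"
  shows "twist_action M p r q"
proof -
  let ?\<sigma> = "dn (Suc q) M"
  have w: "loop M p \<otimes> inv (loop M (Suc q)) = ?\<sigma> \<otimes> X p (Suc q) \<otimes> inv ?\<sigma>"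
    using X_quotient[of p "Suc q" M] assms by (simp add: loop_eq_X)
  have z: "loop M r \<otimes> inv (loop M (Suc q)) = ?\<sigma> \<otimes> X r (Suc q) \<otimes> inv ?\<sigma>"
    using X_quotient[of r "Suc q" M] assms by (simp add: loop_eq_X)
  have "commute ?\<sigma> (T p q)"
    by (rule commute_word) (auto intro!: commute_sym[OF commute_s_word(4)])
  then have "T p q \<otimes> (loop M p \<otimes> inv (loop M (Suc q))) = ?\<sigma> \<otimes> T p (Suc q) \<otimes> inv ?\<sigma>"
    unfolding w using assms commute_left[of ?\<sigma> "T p q"] by (simp add: m_assoc)
  moreover have "commute (T p (Suc q)) (X r (Suc q))"
    using assms by (intro commute_sym[OF commute_word(3)]) (auto intro!: commute_s_T simp del: T.simps)
  ultimately show ?thesis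
    unfolding twist_action_def z by (simp add: commute_conj)
qed

sublocale twists G T N
  by unfold_locales (auto intro!: lantern_if_twist_action braid_twist_action)

end

section \<open>Subgroups normalized by a set of generators\<close>

context group
begin

lemma conj_generate:
  assumes "subgroup H G" "S \<subseteq> carrier G" "g \<in> carrier G" "\<And>y. y \<in> S \<Longrightarrow> g \<otimes> y \<otimes> inv g \<in> H"
    and "y \<in> generate G S"
  shows "g \<otimes> y \<otimes> inv g \<in> H"
  using assms(5)
proof (induction rule: generate.induct)
  case one
  then show ?case using assms by (simp add: subgroup.one_closed)
next
  case (incl h)
  then show ?case using assms by simp
next
  case (inv h)
  then have "h \<in> carrier G" using assms by auto
  then have "g \<otimes> inv h \<otimes> inv g = inv (g \<otimes> h \<otimes> inv g)"
    using assms by (simp add: inv_mult_group m_assoc)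
  then show ?case using assms inv by (simp add: subgroup.m_inv_closed)
next
  case (eng h1 h2)
  then have "h1 \<in> carrier G" "h2 \<in> carrier G"
    using assms(2) generate_in_carrier by blast+
  then have "g \<otimes> (h1 \<otimes> h2) \<otimes> inv g = (g \<otimes> h1 \<otimes> inv g) \<otimes> (g \<otimes> h2 \<otimes> inv g)"
    using assms by (simp add: m_assoc)
  then show ?case using assms eng by (simp add: subgroup.m_closed)
qed

text \<open>Both u and its inverse have to be tested: conjugation by u alone could map an infinite
  subgroup onto a proper part of itself.\<close>

lemma generate_normalizes:
  assumes "S \<subseteq> carrier G" "U \<subseteq> carrier G"
    and "\<And>u y. u \<in> U \<Longrightarrow> y \<in> S \<Longrightarrow> u \<otimes> y \<otimes> inv u \<in> generate G S"
    and "\<And>u y. u \<in> U \<Longrightarrow> y \<in> S \<Longrightarrow> inv u \<otimes> y \<otimes> u \<in> generate G S"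
    and "b \<in> generate G U" "f \<in> generate G S"
  shows "b \<otimes> f \<otimes> inv b \<in> generate G S"
  using assms(5,6)
proof (induction arbitrary: f rule: generate.induct)
  case one
  then show ?case using assms(1) generate_in_carrier by simp
next
  case (incl u)
  then show ?case
    using assms(1-3) by - (rule conj_generate[OF generate_is_subgroup, of S S], auto)
next
  case (inv u)
  then have u: "u \<in> carrier G" using assms(2) by auto
  show ?case
    using assms(1,4) inv u by - (rule conj_generate[OF generate_is_subgroup, of S S], auto)
next
  case (eng b1 b2)
  then have "b1 \<in> carrier G" "b2 \<in> carrier G" "f \<in> carrier G"
    using assms(1,2) generate_in_carrier by blast+
  then have "b1 \<otimes> b2 \<otimes> f \<otimes> inv (b1 \<otimes> b2) = b1 \<otimes> (b2 \<otimes> f \<otimes> inv b2) \<otimes> inv b1"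
    by (simp add: m_assoc inv_mult_group)
  then show ?case using eng by simp
qed

lemma subgroup_normalized_product:
  assumes "S \<subseteq> carrier G" "U \<subseteq> carrier G"
    and "\<And>u y. u \<in> U \<Longrightarrow> y \<in> S \<Longrightarrow> u \<otimes> y \<otimes> inv u \<in> generate G S"
    and "\<And>u y. u \<in> U \<Longrightarrow> y \<in> S \<Longrightarrow> inv u \<otimes> y \<otimes> u \<in> generate G S"
  shows "subgroup {f \<otimes> b | f b. f \<in> generate G S \<and> b \<in> generate G U} G"
    (is "subgroup ?P G")
proof (rule subgroupI)
  note norm = generate_normalizes[OF assms]
  have S: "subgroup (generate G S) G" and U: "subgroup (generate G U) G"
    using assms by (auto intro: generate_is_subgroup)
  note mem = subgroup.mem_carrier[OF S] subgroup.mem_carrier[OF U]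
  show "?P \<subseteq> carrier G" using mem by auto
  have "\<one> \<otimes> \<one> \<in> ?P" using generate.one by blast
  then show "?P \<noteq> {}" by blast
  fix g assume "g \<in> ?P"
  then obtain f b where g: "g = f \<otimes> b" "f \<in> generate G S" "b \<in> generate G U" by blast
  have "inv g = (inv b \<otimes> inv f \<otimes> inv (inv b)) \<otimes> inv b"
    using mem g by (simp add: inv_mult_group m_assoc)
  moreover have "inv b \<otimes> inv f \<otimes> inv (inv b) \<in> generate G S"
    using g norm[of "inv b" "inv f"] S U by (simp add: subgroup.m_inv_closed)
  moreover have "inv b \<in> generate G U" using g U by (simp add: subgroup.m_inv_closed)
  ultimately show "inv g \<in> ?P" by blast
  fix g' assume "g' \<in> ?P"
  then obtain f' b' where g': "g' = f' \<otimes> b'" "f' \<in> generate G S" "b' \<in> generate G U" by blast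
  have "g \<otimes> g' = (f \<otimes> (b \<otimes> f' \<otimes> inv b)) \<otimes> (b \<otimes> b')"
    using mem g g' by (simp add: m_assoc)
  moreover have "f \<otimes> (b \<otimes> f' \<otimes> inv b) \<in> generate G S"
    using g g' norm[of b f'] S by (simp add: subgroup.m_closed)
  moreover have "b \<otimes> b' \<in> generate G U" using g g' U by (simp add: subgroup.m_closed)
  ultimately show "g \<otimes> g' \<in> ?P" by blast
qed

end

section \<open>Factoring off the loops of the last strand\<close>

context twists_base
begin

definition twist_gens :: "nat \<Rightarrow> 'a set" where
  "twist_gens M = {t p q | p q. 1 \<le> p \<and> p < q \<and> q \<le> M}"

definition loop_gens :: "nat \<Rightarrow> 'a set" where
  "loop_gens M = {loop M r | r. 1 \<le> r \<and> r < M}"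

lemma gens_carrier: "twist_gens M \<subseteq> carrier G" "loop_gens M \<subseteq> carrier G"
  by (auto simp: twist_gens_def loop_gens_def)

lemma t_in_generate: "1 \<le> p \<Longrightarrow> q \<le> M \<Longrightarrow> t p q \<in> generate G (twist_gens M)"
  by (cases "p < q") (auto simp: twist_gens_def intro: generate.incl generate.one)

lemma loop_in_loops: "1 \<le> r \<Longrightarrow> loop M r \<in> generate G (loop_gens M)"
  by (cases "r < M") (auto simp: loop_gens_def intro: generate.incl generate.one)

lemma loop_in_twists: "1 \<le> r \<Longrightarrow> loop M r \<in> generate G (twist_gens M)"
  unfolding loop_def
  by (intro generate.eng generate_m_inv_closed t_in_generate gens_carrier) auto

lemma loops_subset_twists: "generate G (loop_gens M) \<subseteq> generate G (twist_gens M)"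
  by (rule generate_subgroup_incl)
    (auto simp: loop_gens_def intro!: loop_in_twists generate_is_subgroup gens_carrier)

lemma twists_mono: "L \<le> M \<Longrightarrow> generate G (twist_gens L) \<subseteq> generate G (twist_gens M)"
  by (rule mono_generate) (use le_trans in \<open>unfold twist_gens_def, blast\<close>)

end

context twists
begin

lemma conj_loop:
  assumes "1 \<le> p" "1 \<le> r" "q < M" "M \<le> N"
  shows "t p q \<otimes> loop M r \<otimes> inv (t p q) \<in> generate G (loop_gens M)"
    and "inv (t p q) \<otimes> loop M r \<otimes> t p q \<in> generate G (loop_gens M)"
proof -
  note sub = generate_is_subgroup[OF gens_carrier(2)[of M]]
  have "t p q \<otimes> loop M r \<otimes> inv (t p q) \<in> generate G (loop_gens M) \<and>
    inv (t p q) \<otimes> loop M r \<otimes> t p q \<in> generate G (loop_gens M)"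
  proof (cases "r \<le> p \<or> q < r")
    case True
    then have c: "commute (t p q) (loop M r)" using assms by (auto intro: commute_t_loop)
    have "t p q \<otimes> loop M r \<otimes> inv (t p q) = loop M r" "inv (t p q) \<otimes> loop M r \<otimes> t p q = loop M r"
      using commuteD(3)[OF c] commuteD(3)[OF commute_inv[OF c]] by (simp_all add: m_assoc)
    then show ?thesis using loop_in_loops[of r M] assms by simp
  next
    case False
    \<comment> \<open>Here p < r \<le> q. The twist commutes with u and w, and its product with w
      commutes with z; so it conjugates z exactly as \<open>inv w\<close> does and fixes u, and u,
      w, z are all products of loops.\<close>
    define u where "u = loop M (Suc q)"
    define w where "w = loop M p \<otimes> inv u"
    define z where "z = loop M r \<otimes> inv u"
    have cl [simp]: "u \<in> carrier G" "w \<in> carrier G" "z \<in> carrier G"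
      by (simp_all add: u_def w_def z_def)
    have "loop M p \<in> generate G (loop_gens M)" "loop M r \<in> generate G (loop_gens M)"
      "u \<in> generate G (loop_gens M)"
      using assms by (auto intro!: loop_in_loops simp: u_def)
    then have mem: "u \<in> generate G (loop_gens M)" "w \<in> generate G (loop_gens M)"
      "z \<in> generate G (loop_gens M)"
      by (auto simp: w_def z_def subgroup.m_closed[OF sub] subgroup.m_inv_closed[OF sub])
    have tw: "commute (t p q \<otimes> w) z"
      using twist_action_holds[of p r q M] False assms
      by (simp add: twist_action_def w_def z_def u_def)
    have tu: "commute (t p q) u"
      unfolding u_def using assms by (intro commute_t_loop) auto
    have "commute (t p q) w"
      unfolding w_def using assms tu by (intro commute_mult_right commute_inv_right commute_t_loop) auto
    then have e: "w \<otimes> (t p q \<otimes> z) = z \<otimes> (w \<otimes> t p q)" "t p q \<otimes> (w \<otimes> z) = z \<otimes> (t p q \<otimes> w)"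
      using commuteD(3)[OF tw] by (simp_all add: m_assoc commute_def flip: m_assoc)
    have "t p q \<otimes> z = inv w \<otimes> (w \<otimes> (t p q \<otimes> z))" by simp
    then have tz: "t p q \<otimes> z = inv w \<otimes> z \<otimes> w \<otimes> t p q"
      unfolding e(1) by (simp add: m_assoc)
    have "z \<otimes> t p q = t p q \<otimes> (w \<otimes> (z \<otimes> inv w))"
    proof -
      have "t p q \<otimes> (w \<otimes> (z \<otimes> inv w)) = (t p q \<otimes> (w \<otimes> z)) \<otimes> inv w" by (simp add: m_assoc)
      then show ?thesis unfolding e(2) by (simp add: m_assoc)
    qed
    then have zt: "inv (t p q) \<otimes> (z \<otimes> t p q) = w \<otimes> (z \<otimes> inv w)" by simp
    have x: "loop M r = z \<otimes> u" by (simp add: z_def m_assoc)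
    have "t p q \<otimes> loop M r \<otimes> inv (t p q) = (t p q \<otimes> z) \<otimes> (u \<otimes> inv (t p q))"
      by (simp add: x m_assoc)
    also have "\<dots> = inv w \<otimes> z \<otimes> w \<otimes> u"
      unfolding tz using commute_left[OF tu] by (simp add: m_assoc)
    finally have 1: "t p q \<otimes> loop M r \<otimes> inv (t p q) = inv w \<otimes> z \<otimes> w \<otimes> u" .
    have "inv (t p q) \<otimes> loop M r \<otimes> t p q = inv (t p q) \<otimes> (z \<otimes> t p q) \<otimes> u"
      using commuteD(3)[OF tu] by (simp add: x m_assoc)
    also have "\<dots> = w \<otimes> z \<otimes> inv w \<otimes> u"
      unfolding zt by (simp add: m_assoc)
    finally have 2: "inv (t p q) \<otimes> loop M r \<otimes> t p q = w \<otimes> z \<otimes> inv w \<otimes> u" .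
    show ?thesis
      unfolding 1 2 by (simp add: mem subgroup.m_closed[OF sub] subgroup.m_inv_closed[OF sub])
  qed
  then show "t p q \<otimes> loop M r \<otimes> inv (t p q) \<in> generate G (loop_gens M)"
    and "inv (t p q) \<otimes> loop M r \<otimes> t p q \<in> generate G (loop_gens M)" by auto
qed

lemma twist_decomposition:
  assumes "Suc M \<le> N" "g \<in> generate G (twist_gens (Suc M))"
  obtains f g' where "g = f \<otimes> g'" "f \<in> generate G (loop_gens (Suc M))" "g' \<in> generate G (twist_gens M)"
proof -
  let ?P = "{f \<otimes> b | f b. f \<in> generate G (loop_gens (Suc M)) \<and> b \<in> generate G (twist_gens M)}"
  have P: "subgroup ?P G"
  proof (rule subgroup_normalized_product[OF gens_carrier(2,1)])
    fix u y assume "u \<in> twist_gens M" "y \<in> loop_gens (Suc M)"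
    then obtain p q r where "u = t p q" "y = loop (Suc M) r" "1 \<le> p" "q < Suc M" "1 \<le> r"
      by (auto simp: twist_gens_def loop_gens_def)
    then show "u \<otimes> y \<otimes> inv u \<in> generate G (loop_gens (Suc M))"
      "inv u \<otimes> y \<otimes> u \<in> generate G (loop_gens (Suc M))"
      using conj_loop[of p r q "Suc M"] assms by auto
  qed
  have "twist_gens (Suc M) \<subseteq> ?P"
  proof
    fix y assume "y \<in> twist_gens (Suc M)"
    then obtain p q where y: "y = t p q" "1 \<le> p" "p < q" "q \<le> Suc M" by (auto simp: twist_gens_def)
    show "y \<in> ?P"
    proof (cases "q = Suc M")
      case True
      then have "y = loop (Suc M) p \<otimes> t p M" using t_eq[of p "Suc M"] y by simp
      then show ?thesis using y loop_in_loops[of p "Suc M"] t_in_generate[of p M M] by blast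
    next
      case False
      then have "y = \<one> \<otimes> t p q" "t p q \<in> generate G (twist_gens M)"
        using y by (auto intro: t_in_generate)
      then show ?thesis using generate.one by blast
    qed
  qed
  then have "generate G (twist_gens (Suc M)) \<subseteq> ?P"
    using P by (rule generate_subgroup_incl)
  then show ?thesis using assms(2) that by blast
qed

end

section \<open>Pure braids are products of full twists\<close>

context braid
begin

text \<open>With a = \<open>s m\<close> and b = \<open>s (m + 1)\<close> and after removing the
  common outer letters, this is a b^2 a^-1 = b^-1 a^2 b. The loop treated here is the one that
  encloses strand m + 1 but not strand m.\<close>

lemma conj_s_loop:
  assumes "1 \<le> m" "m + 2 \<le> M" "M \<le> N"
  shows "s m \<otimes> X (m + 1) M \<otimes> inv (s m) = X (m + 2) M \<otimes> inv (X (m + 1) M) \<otimes> X m M"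
proof -
  define a b \<sigma> \<tau> where "a = s m" and "b = s (m + 1)" and "\<sigma> = dn (m + 2) M" and "\<tau> = up (m + 2) M"
  have [simp]: "a \<in> carrier G" "b \<in> carrier G" "\<sigma> \<in> carrier G" "\<tau> \<in> carrier G"
    by (simp_all add: a_def b_def \<sigma>_def \<tau>_def)
  have X: "X (m + 2) M = \<sigma> \<otimes> \<tau>" "X (m + 1) M = \<sigma> \<otimes> (b \<otimes> (b \<otimes> \<tau>))"
    "X m M = \<sigma> \<otimes> (b \<otimes> (a \<otimes> (a \<otimes> (b \<otimes> \<tau>))))"
    using assms dn_left[of m M] dn_left[of "Suc m" M] up_left[of m M] up_left[of "Suc m" M]
    by (simp_all add: X_def a_def b_def \<sigma>_def \<tau>_def m_assoc)
  have c: "commute a \<sigma>" "commute a \<tau>"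
    by (auto simp: a_def \<sigma>_def \<tau>_def intro!: commute_sym[OF commute_s_word(1)] commute_sym[OF commute_s_word(2)])
  have br: "a \<otimes> (b \<otimes> a) = b \<otimes> (a \<otimes> b)"
    using s_braid[of m] assms by (simp add: a_def b_def)
  have "b \<otimes> (a \<otimes> (b \<otimes> b)) = a \<otimes> (a \<otimes> (b \<otimes> a))"
  proof -
    have "b \<otimes> (a \<otimes> (b \<otimes> b)) = (a \<otimes> (b \<otimes> a)) \<otimes> b" unfolding br by (simp add: m_assoc)
    also have "\<dots> = a \<otimes> (b \<otimes> (a \<otimes> b))" by (simp add: m_assoc)
    also have "\<dots> = a \<otimes> (a \<otimes> (b \<otimes> a))" by (simp flip: br)
    finally show ?thesis .
  qed
  then have "inv b \<otimes> (b \<otimes> (a \<otimes> (b \<otimes> b))) \<otimes> inv a = inv b \<otimes> (a \<otimes> (a \<otimes> (b \<otimes> a))) \<otimes> inv a"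
    by simp
  then have k: "a \<otimes> (b \<otimes> (b \<otimes> inv a)) = inv b \<otimes> (a \<otimes> (a \<otimes> b))"
    by (simp add: m_assoc)
  have "a \<otimes> (\<sigma> \<otimes> (b \<otimes> (b \<otimes> \<tau>))) \<otimes> inv a = \<sigma> \<otimes> ((a \<otimes> (b \<otimes> (b \<otimes> inv a))) \<otimes> \<tau>)"
    using commute_left[OF c(1)] commuteD(3)[OF commute_inv[OF c(2)]] by (simp add: m_assoc)
  also have "\<dots> = \<sigma> \<otimes> \<tau> \<otimes> inv (\<sigma> \<otimes> (b \<otimes> (b \<otimes> \<tau>))) \<otimes> (\<sigma> \<otimes> (b \<otimes> (a \<otimes> (a \<otimes> (b \<otimes> \<tau>)))))"
    unfolding k by (simp add: m_assoc inv_mult_group)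
  finally show ?thesis unfolding X a_def[symmetric] .
qed

lemma conj_s_loops:
  assumes "1 \<le> m" "Suc m < M" "M \<le> N" "1 \<le> r" "r < M"
  shows "s m \<otimes> X r M \<otimes> inv (s m) \<in> generate G (loop_gens M)"
    and "inv (s m) \<otimes> X r M \<otimes> s m \<in> generate G (loop_gens M)"
proof -
  note sub = generate_is_subgroup[OF gens_carrier(2)[of M]]
  have mem: "X i M \<in> generate G (loop_gens M)" if "1 \<le> i" for i
    using loop_in_loops[OF that, of M] loop_eq_X that assms by simp
  have comm: "commute (s m) (X i M)" if "1 \<le> i" "i \<le> m \<or> m + 1 < i" for i
    using that assms commute_sym[OF commute_s_word(3)[of m i M]] commute_s_X[of i m M] by auto
  have "s m \<otimes> X r M \<otimes> inv (s m) \<in> generate G (loop_gens M) \<and>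
     inv (s m) \<otimes> X r M \<otimes> s m \<in> generate G (loop_gens M)"
  proof (cases "r = m + 1")
    case False
    then have "r \<le> m \<or> m + 1 < r" by linarith
    then have c: "commute (s m) (X r M)" using comm assms by blast
    have "s m \<otimes> X r M \<otimes> inv (s m) = X r M" "inv (s m) \<otimes> X r M \<otimes> s m = X r M"
      using commuteD(3)[OF c] commuteD(3)[OF commute_inv[OF c]] by (simp_all add: m_assoc)
    then show ?thesis using mem assms by simp
  next
    case True
    define A B C where "A = X m M" and "B = X (m + 1) M" and "C = X (m + 2) M"
    have [simp]: "A \<in> carrier G" "B \<in> carrier G" "C \<in> carrier G" by (simp_all add: A_def B_def C_def)
    have F: "A \<in> generate G (loop_gens M)" "B \<in> generate G (loop_gens M)" "C \<in> generate G (loop_gens M)"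
      using mem assms by (auto simp: A_def B_def C_def)
    have c: "commute (s m) A" "commute (s m) C" using comm assms by (auto simp: A_def C_def)
    have 1: "s m \<otimes> B \<otimes> inv (s m) = C \<otimes> inv B \<otimes> A"
      using conj_s_loop[of m M] assms by (simp add: A_def B_def C_def)
    \<comment> \<open>Conjugating the claimed value by \<open>s m\<close> and inserting formula 1
      gives B back.\<close>
    have 2: "inv (s m) \<otimes> B \<otimes> s m = A \<otimes> inv B \<otimes> C"
    proof -
      have "s m \<otimes> (A \<otimes> inv B \<otimes> C) \<otimes> inv (s m) = A \<otimes> inv (s m \<otimes> B \<otimes> inv (s m)) \<otimes> C"
        using commute_left[OF c(1)] commuteD(3)[OF commute_inv[OF c(2)]]
        by (simp add: m_assoc inv_mult_group)
      also have "\<dots> = B" unfolding 1 by (simp add: m_assoc inv_mult_group)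
      finally have "inv (s m) \<otimes> (s m \<otimes> (A \<otimes> inv B \<otimes> C) \<otimes> inv (s m)) \<otimes> s m = inv (s m) \<otimes> B \<otimes> s m"
        by simp
      then show ?thesis by (simp add: m_assoc)
    qed
    show ?thesis
      unfolding True B_def[symmetric] 1 2
      using F by (simp add: subgroup.m_closed[OF sub] subgroup.m_inv_closed[OF sub])
  qed
  then show "s m \<otimes> X r M \<otimes> inv (s m) \<in> generate G (loop_gens M)"
    and "inv (s m) \<otimes> X r M \<otimes> s m \<in> generate G (loop_gens M)" by auto
qed

lemma loop_gens_X: "M \<le> N \<Longrightarrow> loop_gens M = {X r M | r. 1 \<le> r \<and> r < M}"
  unfolding loop_gens_def using loop_eq_X by force

text \<open>The braids in which strand \<open>M + 1\<close> ends where it began.\<close>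

definition last_fixed :: "nat \<Rightarrow> 'a set" where
  "last_fixed M = {f \<otimes> b | f b. f \<in> generate G (loop_gens (Suc M)) \<and> b \<in> generate G (s ` {1..<M})}"

lemma subgroup_last_fixed: "Suc M \<le> N \<Longrightarrow> subgroup (last_fixed M) G"
  unfolding last_fixed_def
proof (rule subgroup_normalized_product[OF gens_carrier(2)])
  fix u y assume N: "Suc M \<le> N" and "u \<in> s ` {1..<M}" "y \<in> loop_gens (Suc M)"
  then obtain m r where "u = s m" "y = X r (Suc M)" "1 \<le> m" "m < M" "1 \<le> r" "r < Suc M"
    by (auto simp: loop_gens_X)
  then show "u \<otimes> y \<otimes> inv u \<in> generate G (loop_gens (Suc M))"
    "inv u \<otimes> y \<otimes> u \<in> generate G (loop_gens (Suc M))"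
    using conj_s_loops[of m "Suc M" r] N by auto
qed auto

text \<open>The representative \<open>dn k (Suc M)\<close> belongs to the braids whose permutation
  sends k to M + 1. Multiplication by \<open>s m\<close> exchanges k = m with k = m + 1 and keeps
  the other cosets; the second equation is recorded because it yields multiplication by the inverse
  of \<open>s m\<close>.\<close>

lemma coset_step:
  assumes "Suc M \<le> N" "m \<in> {1..M}" "k \<in> {1..Suc M}"
  shows "\<exists>k'\<in>{1..Suc M}. \<exists>e\<in>last_fixed M. \<exists>e'\<in>last_fixed M.
    dn k (Suc M) \<otimes> s m = e \<otimes> dn k' (Suc M) \<and> dn k' (Suc M) \<otimes> s m = e' \<otimes> dn k (Suc M)"
proof -
  note sub = subgroup_last_fixed[OF assms(1)]
  have s: "s i \<in> last_fixed M" if "1 \<le> i" "i < M" for i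
  proof -
    have "s i = \<one> \<otimes> s i" by simp
    then show ?thesis unfolding last_fixed_def
      using generate.one[of G] generate.incl[of "s i" "s ` {1..<M}" G] that by fastforce
  qed
  have F: "f \<in> last_fixed M" if "f \<in> generate G (loop_gens (Suc M))" for f
  proof -
    have "f = f \<otimes> \<one>" using generate_in_carrier[OF gens_carrier(2) that] by simp
    then show ?thesis unfolding last_fixed_def using that generate.one[of G] by blast
  qed
  have adj: "\<exists>e\<in>last_fixed M. \<exists>e'\<in>last_fixed M.
    dn m (Suc M) \<otimes> s m = e \<otimes> dn (Suc m) (Suc M) \<and> dn (Suc m) (Suc M) \<otimes> s m = e' \<otimes> dn m (Suc M)"
  proof -
    have "X m (Suc M) \<otimes> inv (X (Suc m) (Suc M)) \<in> generate G (loop_gens (Suc M))"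
      using loop_in_loops[of m "Suc M"] loop_in_loops[of "Suc m" "Suc M"] assms
      by (intro generate.eng generate_m_inv_closed gens_carrier) (auto simp: loop_eq_X)
    then have "X m (Suc M) \<otimes> inv (X (Suc m) (Suc M)) \<in> last_fixed M" by (rule F)
    \<comment> \<open>This is \<open>X_quotient\<close> for q = m + 1, where
      \<open>X m (Suc m)\<close> is the square of \<open>s m\<close>.\<close>
    moreover have "dn m (Suc M) \<otimes> s m = X m (Suc M) \<otimes> inv (X (Suc m) (Suc M)) \<otimes> dn (Suc m) (Suc M)"
      using X_quotient[of m "Suc m" "Suc M"] dn_left[of m "Suc M"] assms
      by (simp add: m_assoc X_Suc del: dn.simps)
    moreover have "\<one> \<in> last_fixed M" by (rule subgroup.one_closed[OF sub])
    moreover have "dn (Suc m) (Suc M) \<otimes> s m = \<one> \<otimes> dn m (Suc M)"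
      using dn_left[of m "Suc M"] assms by (simp del: dn.simps)
    ultimately show ?thesis by blast
  qed
  consider "m + 1 < k" | "k = Suc m" | "k = m" | "k < m" by linarith
  then show ?thesis
  proof cases
    case 1
    then have "dn k (Suc M) \<otimes> s m = s m \<otimes> dn k (Suc M)"
      using commute_s_word(1)[of m k "Suc M"] by (simp add: commute_def del: dn.simps)
    then show ?thesis using s[of m] 1 assms by (intro bexI[of _ k] bexI[of _ "s m"]) auto
  next
    case 2
    then show ?thesis using adj assms by (intro bexI[of _ m]) (auto simp del: dn.simps)
  next
    case 3
    then show ?thesis using adj assms by (intro bexI[of _ "Suc m"]) (auto simp del: dn.simps)
  next
    case 4
    then have "dn k (Suc M) \<otimes> s m = s (m - 1) \<otimes> dn k (Suc M)"
      using dn_s[of k m "Suc M"] assms by (simp del: dn.simps)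
    then show ?thesis using s[of "m - 1"] 4 assms by (intro bexI[of _ k] bexI[of _ "s (m - 1)"]) auto
  qed
qed

text \<open>Right multiplication by generators never leaves the listed cosets, and it starts at the
  neutral element, whose representative is the empty word for k = M + 1.\<close>

lemma coset_decomposition:
  assumes "Suc M \<le> N" "g \<in> generate G (s ` {1..M})"
  obtains e k where "k \<in> {1..Suc M}" "e \<in> last_fixed M" "g = e \<otimes> dn k (Suc M)"
proof -
  note sub = subgroup_last_fixed[OF assms(1)]
  note mem [simp] = subgroup.mem_carrier[OF sub]
  let ?P = "{e \<otimes> dn k (Suc M) | e k. k \<in> {1..Suc M} \<and> e \<in> last_fixed M}"
  have P: "?P \<subseteq> carrier G" by (auto simp del: dn.simps)
  have "\<forall>y\<in>?P. y \<otimes> g \<in> ?P"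
    using assms(2)
  proof (induction rule: generate.induct)
    case one
    show ?case
    proof
      fix y assume y: "y \<in> ?P"
      have "y \<otimes> \<one> = y" using subsetD[OF P y] by (rule r_one)
      then show "y \<otimes> \<one> \<in> ?P" using y by (simp only:)
    qed
  next
    case (incl h)
    then obtain m where m: "m \<in> {1..M}" "h = s m" by auto
    show ?case
    proof
      fix y assume "y \<in> ?P"
      then obtain e k where y: "y = e \<otimes> dn k (Suc M)" "k \<in> {1..Suc M}" "e \<in> last_fixed M" by blast
      obtain e' k' where "e' \<in> last_fixed M" "k' \<in> {1..Suc M}" "dn k (Suc M) \<otimes> s m = e' \<otimes> dn k' (Suc M)"
        using coset_step[OF assms(1) m(1) y(2)] by blast
      then have "y \<otimes> h = (e \<otimes> e') \<otimes> dn k' (Suc M)" "e \<otimes> e' \<in> last_fixed M" "k' \<in> {1..Suc M}"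
        using y m subgroup.m_closed[OF sub] by (auto simp: m_assoc simp del: dn.simps)
      then show "y \<otimes> h \<in> ?P" by blast
    qed
  next
    case (inv h)
    then obtain m where m: "m \<in> {1..M}" "h = s m" by auto
    show ?case
    proof
      fix y assume "y \<in> ?P"
      then obtain e k where y: "y = e \<otimes> dn k (Suc M)" "k \<in> {1..Suc M}" "e \<in> last_fixed M" by blast
      obtain e' k' where e': "e' \<in> last_fixed M" "k' \<in> {1..Suc M}"
        "dn k' (Suc M) \<otimes> s m = e' \<otimes> dn k (Suc M)"
        using coset_step[OF assms(1) m(1) y(2)] by blast
      have "dn k (Suc M) = inv e' \<otimes> (dn k' (Suc M) \<otimes> s m)"
        unfolding e'(3) using e'(1) by (simp del: dn.simps)
      then have "y \<otimes> inv h = (e \<otimes> inv e') \<otimes> dn k' (Suc M)"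
        using y(1,3) m e'(1) by (simp add: m_assoc del: dn.simps)
      moreover have "e \<otimes> inv e' \<in> last_fixed M"
        using y(3) e'(1) by (intro subgroup.m_closed[OF sub] subgroup.m_inv_closed[OF sub])
      ultimately show "y \<otimes> inv h \<in> ?P" using e'(2) by blast
    qed
  next
    case (eng h1 h2)
    have h: "h1 \<in> carrier G" "h2 \<in> carrier G"
      by (rule generate_in_carrier[OF _ eng.hyps(1)], auto)
         (rule generate_in_carrier[OF _ eng.hyps(2)], auto)
    show ?case
    proof
      fix y assume y: "y \<in> ?P"
      have "y \<otimes> h1 \<otimes> h2 \<in> ?P" using y eng.IH by blast
      moreover have "y \<otimes> h1 \<otimes> h2 = y \<otimes> (h1 \<otimes> h2)"
        using subsetD[OF P y] h by (rule m_assoc)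
      ultimately show "y \<otimes> (h1 \<otimes> h2) \<in> ?P" by (simp only:)
    qed
  qed
  moreover have "\<one> \<otimes> dn (Suc M) (Suc M) \<in> ?P"
    using subgroup.one_closed[OF sub] by fastforce
  moreover have "g \<in> carrier G"
    by (rule generate_in_carrier[OF _ assms(2)]) auto
  ultimately have "g \<in> ?P" by fastforce
  then show ?thesis using that by blast
qed

text \<open>\<open>X p (Suc q)\<close> is \<open>X p q\<close> between two copies of
  \<open>s q\<close>, whose transpositions cancel.\<close>

lemma pure_words:
  assumes \<pi>: "\<pi> \<in> hom G (sym_group N)" "\<And>i. 1 \<le> i \<Longrightarrow> i < N \<Longrightarrow> \<pi> (s i) = transpose i (i + 1)"
    and "1 \<le> p" "q \<le> N"
  shows "\<pi> (X p q) = id" "\<pi> (T p q) = id"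
proof -
  interpret \<pi>: group_hom G "sym_group N" \<pi>
    using \<pi>(1) sym_group_is_group by (simp add: group_hom_def group_hom_axioms_def is_group)
  have X: "\<pi> (X p q) = id" if "q \<le> N" for q
    using that
  proof (induction q)
    case (Suc q)
    then show ?case
      using \<pi>(2)[of q] assms(3)
      by (cases "p \<le> q") (auto simp: X_Suc sym_group_mult sym_group_one fun_eq_iff)
  qed (simp add: sym_group_one)
  then show "\<pi> (X p q) = id" using assms by simp
  show "\<pi> (T p q) = id"
    using assms(4) by (induction q) (auto simp: X sym_group_mult sym_group_one)
qed

lemma pure_generated:
  assumes \<pi>: "\<pi> \<in> hom G (sym_group N)" "\<And>i. 1 \<le> i \<Longrightarrow> i < N \<Longrightarrow> \<pi> (s i) = transpose i (i + 1)"
    and "M \<le> N" "g \<in> generate G (s ` {1..<M})" "\<pi> g = id"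
  shows "g \<in> generate G (twist_gens M)"
  using assms(3-5)
proof (induction M arbitrary: g)
  case 0
  then show ?case using generate.one generate_empty by auto
next
  case (Suc M)
  interpret \<pi>: group_hom G "sym_group N" \<pi>
    using \<pi>(1) sym_group_is_group by (simp add: group_hom_def group_hom_axioms_def is_group)
  have mult: "\<pi> (a \<otimes> b) = \<pi> a \<circ> \<pi> b" if "a \<in> carrier G" "b \<in> carrier G" for a b
    using \<pi>.hom_mult[OF that] by (simp add: sym_group_mult)
  have one: "\<pi> \<one> = id" using \<pi>.hom_one by (simp add: sym_group_one)
  have inv: "\<pi> (inv a) \<circ> \<pi> a = id" if "a \<in> carrier G" for a
    using mult[of "inv a" a] that one by simp
  show ?case
  proof (cases "M = 0")
    case True
    then show ?thesis using Suc.prems generate.one generate_empty by auto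
  next
    case False
    have "{1..<Suc M} = {1..M}" by auto
    then have "g \<in> generate G (s ` {1..M})" using Suc.prems by simp
    then obtain e k where k: "k \<in> {1..Suc M}" "e \<in> last_fixed M" "g = e \<otimes> dn k (Suc M)"
      by (rule coset_decomposition[OF Suc.prems(1)])
    then obtain f b where e: "e = f \<otimes> b" "f \<in> generate G (loop_gens (Suc M))"
      "b \<in> generate G (s ` {1..<M})"
      by (auto simp: last_fixed_def)
    have [simp]: "f \<in> carrier G" "b \<in> carrier G"
      using e by (auto intro: generate_in_carrier[OF gens_carrier(2)] generate_in_carrier[of "s ` {1..<M}"])
    note X_pure = pure_words(1)[OF \<pi>]
    have "loop_gens (Suc M) \<subseteq> kernel G (sym_group N) \<pi>"
      using Suc.prems by (auto simp: loop_gens_X kernel_def sym_group_one X_pure)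
    then have "generate G (loop_gens (Suc M)) \<subseteq> kernel G (sym_group N) \<pi>"
      by (rule generate_subgroup_incl) (rule \<pi>.subgroup_kernel)
    then have f: "\<pi> f = id" using e by (auto simp: kernel_def sym_group_one)
    have "subgroup {a \<in> carrier G. \<pi> a (Suc M) = Suc M} G"
    proof (rule subgroupI)
      fix a assume "a \<in> {a \<in> carrier G. \<pi> a (Suc M) = Suc M}"
      then show "inv a \<in> {a \<in> carrier G. \<pi> a (Suc M) = Suc M}"
        using inv[of a] by (auto simp: fun_eq_iff dest: spec[of _ "Suc M"])
    qed (auto simp: sym_group_mult sym_group_one intro!: exI[of _ "\<one>"])
    moreover have "s ` {1..<M} \<subseteq> {a \<in> carrier G. \<pi> a (Suc M) = Suc M}"
      using \<pi>(2) Suc.prems by auto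
    ultimately have b: "\<pi> b (Suc M) = Suc M"
      using e(3) generate_subgroup_incl by blast
    \<comment> \<open>The representative sends k to M + 1, while f is pure and b fixes M + 1. A pure
      g therefore forces k = M + 1, and then the representative is trivial.\<close>
    have "\<pi> (dn k q) k = q" if "k \<le> q" "q \<le> Suc M" for q
      using that
    proof (induction q rule: dec_induct)
      case base
      then show ?case by (simp add: sym_group_one)
    next
      case (step q)
      then show ?case using \<pi>(2)[of q] k Suc.prems by (simp add: sym_group_mult)
    qed
    then have "\<pi> (dn k (Suc M)) k = Suc M" using k by (simp del: dn.simps)
    then have "\<pi> g k = Suc M"
      using k(3) e(1) f b by (simp add: sym_group_mult del: dn.simps)
    then have "k = Suc M" using Suc.prems by simp
    then have g: "g = f \<otimes> b" using k(3) e(1) by simp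
    then have "\<pi> b = id" using Suc.prems f by (simp add: sym_group_mult id_def)
    then have "b \<in> generate G (twist_gens (Suc M))"
      using Suc.IH[of b] e(3) Suc.prems twists_mono[of M "Suc M"] by auto
    moreover have "f \<in> generate G (twist_gens (Suc M))"
      using e(2) loops_subset_twists by auto
    ultimately show ?thesis unfolding g by (rule generate.eng[rotated])
  qed
qed

end

section \<open>The Hurwitz action\<close>

text \<open>A pair \<open>(h, a)\<close> stands for the conjugate \<open>h a h\<^sup>-\<^sup>1\<close> together with the conjugating element
  (an element of a free rack).  Remembering \<open>h\<close> makes it possible to read off how a strand with
  trivial label \<open>a = \<one>\<close> winds around the others.\<close>

context group
begin

text \<open>Every natural number carries a label, so one set is acted on by the braids on any number
  of strands.\<close>

definition labels :: "(nat \<Rightarrow> 'a \<times> 'a) set" where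
  "labels = {v. \<forall>k. v k \<in> carrier G \<times> carrier G}"

definition conjugate :: "'a \<times> 'a \<Rightarrow> 'a" where
  "conjugate z = fst z \<otimes> snd z \<otimes> inv (fst z)"

text \<open>In the rack, (h, a) acts on (h', a') by multiplying h' on the left with the conjugate h
  a h^-1; a' never changes. The label at i acts on its right neighbour while the two change
  places.\<close>

definition hurwitz :: "nat \<Rightarrow> (nat \<Rightarrow> 'a \<times> 'a) \<Rightarrow> nat \<Rightarrow> 'a \<times> 'a" where
  "hurwitz i v = v(i := (conjugate (v i) \<otimes> fst (v (Suc i)), snd (v (Suc i))), Suc i := v i)"

definition hurwitz_perm :: "nat \<Rightarrow> (nat \<Rightarrow> 'a \<times> 'a) \<Rightarrow> nat \<Rightarrow> 'a \<times> 'a" where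
  "hurwitz_perm i = restrict (hurwitz i) labels"

lemma labelsD [simp]:
  assumes "v \<in> labels"
  shows "fst (v k) \<in> carrier G" "snd (v k) \<in> carrier G"
  using assms by (auto simp: labels_def mem_Times_iff)

lemma labels_upd [simp]: "v \<in> labels \<Longrightarrow> z \<in> carrier G \<times> carrier G \<Longrightarrow> v(k := z) \<in> labels"
  by (auto simp: labels_def)

lemma labels_mem [simp]: "v \<in> labels \<Longrightarrow> v k \<in> carrier G \<times> carrier G"
  by (auto simp: labels_def)

lemma conjugate_closed [simp]: "z \<in> carrier G \<times> carrier G \<Longrightarrow> conjugate z \<in> carrier G"
  by (auto simp: conjugate_def)

lemma hurwitz_closed [simp]: "v \<in> labels \<Longrightarrow> hurwitz i v \<in> labels"
  unfolding hurwitz_def by (intro labels_upd) auto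

lemma hurwitz_perm_Bij: "hurwitz_perm i \<in> carrier (BijGroup labels)"
proof -
  define g where "g = (\<lambda>w. w(i := w (Suc i),
    Suc i := (inv (conjugate (w (Suc i))) \<otimes> fst (w i), snd (w i))))"
  have "bij_betw (hurwitz i) labels labels"
  proof (rule bij_betw_byWitness[of _ g])
    show "\<forall>v\<in>labels. g (hurwitz i v) = v" "\<forall>v\<in>labels. hurwitz i (g v) = v"
      by (auto simp: g_def hurwitz_def fun_eq_iff)
    show "hurwitz i ` labels \<subseteq> labels" by auto
    show "g ` labels \<subseteq> labels" unfolding g_def by (intro image_subsetI labels_upd) auto
  qed
  then show ?thesis
    unfolding BijGroup_def Bij_def hurwitz_perm_def
    by (auto cong: bij_betw_cong)
qed

lemma Bij_mult:
  assumes "f \<in> carrier (BijGroup S)" "g \<in> carrier (BijGroup S)"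
  shows "f \<otimes>\<^bsub>BijGroup S\<^esub> g = compose S f g"
  using assms by (simp add: BijGroup_def)

lemma Bij_apply:
  assumes "f \<in> carrier (BijGroup S)" "g \<in> carrier (BijGroup S)" "v \<in> S"
  shows "(f \<otimes>\<^bsub>BijGroup S\<^esub> g) v = f (g v)"
  using assms by (simp add: Bij_mult compose_eq)

lemma Bij_closed: "f \<in> carrier (BijGroup S) \<Longrightarrow> v \<in> S \<Longrightarrow> f v \<in> S"
  by (auto simp: BijGroup_def Bij_def bij_betw_def)

lemma Bij_one: "v \<in> S \<Longrightarrow> \<one>\<^bsub>BijGroup S\<^esub> v = v"
  by (simp add: BijGroup_def)

lemma Bij_eqI:
  assumes "f \<in> carrier (BijGroup S)" "g \<in> carrier (BijGroup S)" "\<And>v. v \<in> S \<Longrightarrow> f v = g v"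
  shows "f = g"
  using assms by (auto simp: BijGroup_def Bij_def intro: extensionalityI)

lemma hurwitz_perm_apply [simp]: "v \<in> labels \<Longrightarrow> hurwitz_perm i v = hurwitz i v"
  by (simp add: hurwitz_perm_def)

lemma hurwitz_far:
  assumes "v \<in> labels" "i + 2 \<le> j"
  shows "hurwitz i (hurwitz j v) = hurwitz j (hurwitz i v)"
  using assms by (auto simp: hurwitz_def fun_eq_iff)

lemma hurwitz_braid:
  assumes "v \<in> labels"
  shows "hurwitz i (hurwitz (Suc i) (hurwitz i v)) = hurwitz (Suc i) (hurwitz i (hurwitz (Suc i) v))"
  using assms by (auto simp: hurwitz_def fun_eq_iff conjugate_def m_assoc inv_mult_group)

lemma braid_hurwitz: "braid (BijGroup labels) hurwitz_perm N"
proof -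
  interpret B: group "BijGroup labels" by (rule group_BijGroup)
  note [simp] = hurwitz_perm_Bij
  show ?thesis
  proof unfold_locales
    fix i j :: nat assume "i + 2 \<le> j"
    then show "hurwitz_perm i \<otimes>\<^bsub>BijGroup labels\<^esub> hurwitz_perm j =
      hurwitz_perm j \<otimes>\<^bsub>BijGroup labels\<^esub> hurwitz_perm i"
      by (intro Bij_eqI[of _ labels]) (auto simp: Bij_apply intro: hurwitz_far)
  next
    fix i :: nat
    show "hurwitz_perm i \<otimes>\<^bsub>BijGroup labels\<^esub> (hurwitz_perm (i + 1) \<otimes>\<^bsub>BijGroup labels\<^esub> hurwitz_perm i)
      = hurwitz_perm (i + 1) \<otimes>\<^bsub>BijGroup labels\<^esub> (hurwitz_perm i \<otimes>\<^bsub>BijGroup labels\<^esub> hurwitz_perm (i + 1))"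
      by (intro Bij_eqI[of _ labels]) (auto simp: Bij_apply hurwitz_braid)
  qed simp
qed

primrec label_product :: "nat \<Rightarrow> nat \<Rightarrow> (nat \<Rightarrow> 'a \<times> 'a) \<Rightarrow> 'a" where
  "label_product p 0 v = \<one>"
| "label_product p (Suc q) v = (if p \<le> q then label_product p q v \<otimes> conjugate (v q) else \<one>)"

lemma label_product_closed [simp]: "v \<in> labels \<Longrightarrow> label_product p q v \<in> carrier G"
  by (induction q) auto

lemma label_product_cong:
  assumes "\<And>k. k < q \<Longrightarrow> v k = w k"
  shows "label_product p q v = label_product p q w"
  using assms by (induction q) auto

lemma label_product_upd [simp]: "q \<le> k \<Longrightarrow> label_product p q (v(k := z)) = label_product p q v"
  by (rule label_product_cong) auto

text \<open>The conjugate of (h, \<one>) is trivial, so the other labels come back unchanged, while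
  the travelling strand collects their conjugates in its first component.\<close>

lemma hurwitz_loop:
  assumes "1 \<le> p" "v \<in> labels" "h \<in> carrier G"
  shows "braid.X (BijGroup labels) hurwitz_perm p q (v(q := (h, \<one>)))
    = v(q := (label_product p q v \<otimes> h, \<one>))"
proof -
  \<comment> \<open>\<open>braid_hurwitz\<close> holds for any number of strands and
    \<open>X\<close> is independent of it; 0 is an arbitrary choice.\<close>
  interpret H: braid "BijGroup labels" hurwitz_perm 0 by (rule braid_hurwitz)
  show ?thesis
    using assms(2,3)
  proof (induction q arbitrary: v h)
    case 0
    then have "v(0 := (h, \<one>)) \<in> labels" by simp
    from Bij_one[OF this] 0 show ?case by (simp only: H.trivial(3) le0 label_product.simps l_one)
  next
    case (Suc q)
    show ?case
    proof (cases "p \<le> q")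
      case False
      have "v(Suc q := (h, \<one>)) \<in> labels" using Suc.prems by simp
      from Bij_one[OF this] False Suc.prems show ?thesis by (simp del: fun_upd_apply)
    next
      case True
      let ?v = "v(Suc q := v q)"
      have 1: "hurwitz q (v(Suc q := (h, \<one>))) = ?v(q := (conjugate (v q) \<otimes> h, \<one>))"
        by (auto simp: hurwitz_def fun_eq_iff)
      have 2: "H.X p q (?v(q := (conjugate (v q) \<otimes> h, \<one>)))
        = ?v(q := (label_product p q v \<otimes> (conjugate (v q) \<otimes> h), \<one>))"
        using Suc.prems by (subst Suc.IH) simp_all
      have 3: "hurwitz q (?v(q := (label_product p q v \<otimes> (conjugate (v q) \<otimes> h), \<one>)))
        = v(Suc q := (label_product p (Suc q) v \<otimes> h, \<one>))"
        using Suc.prems True by (auto simp: hurwitz_def fun_eq_iff conjugate_def[of "(_, _)"] m_assoc)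
      have "H.X p (Suc q) (v(Suc q := (h, \<one>)))
        = hurwitz q (H.X p q (hurwitz q (v(Suc q := (h, \<one>)))))"
        using True Suc.prems Bij_closed[of "H.X p q" labels] hurwitz_perm_Bij
        by (simp add: H.X_Suc Bij_apply)
      then show ?thesis unfolding 1 2 3 .
    qed
  qed
qed

text \<open>One equation says two things: the label at K stays where it is (take z =
  \<open>v K\<close>), and it has no influence on the other labels.\<close>

definition local_perms :: "nat \<Rightarrow> ((nat \<Rightarrow> 'a \<times> 'a) \<Rightarrow> nat \<Rightarrow> 'a \<times> 'a) set" where
  "local_perms K = {f \<in> carrier (BijGroup labels).
     \<forall>v\<in>labels. \<forall>z\<in>carrier G \<times> carrier G. f (v(K := z)) = (f v)(K := z)}"

lemma subgroup_local_perms: "subgroup (local_perms K) (BijGroup labels)"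
proof -
  interpret B: group "BijGroup labels" by (rule group_BijGroup)
  show ?thesis
  proof (rule B.subgroupI)
    fix f assume f: "f \<in> local_perms K"
    then have fc: "f \<in> carrier (BijGroup labels)" by (simp add: local_perms_def)
    let ?g = "inv\<^bsub>BijGroup labels\<^esub> f"
    have gc: "?g \<in> carrier (BijGroup labels)" using fc by simp
    have "?g (v(K := z)) = (?g v)(K := z)" if v: "v \<in> labels" "z \<in> carrier G \<times> carrier G" for v z
    proof -
      have gv: "?g v \<in> labels" using Bij_closed[OF gc v(1)] .
      have "v = f (?g v)"
        using Bij_apply[OF fc gc v(1)] B.r_inv[OF fc] v by (simp add: Bij_one)
      then have "v(K := z) = f ((?g v)(K := z))"
        using f gv v unfolding local_perms_def by auto
      then have "?g (v(K := z)) = (?g \<otimes>\<^bsub>BijGroup labels\<^esub> f) ((?g v)(K := z))"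
        using Bij_apply[OF gc fc, of "(?g v)(K := z)"] gv v by simp
      then show ?thesis using B.l_inv[OF fc] gv v by (simp add: Bij_one)
    qed
    then show "?g \<in> local_perms K" using gc by (simp add: local_perms_def)
  next
    show "local_perms K \<noteq> {}"
      using B.one_closed by (auto simp: local_perms_def Bij_one intro!: exI[of _ "\<one>\<^bsub>BijGroup labels\<^esub>"])
  next
    fix f g assume fg: "f \<in> local_perms K" "g \<in> local_perms K"
    then have c: "f \<in> carrier (BijGroup labels)" "g \<in> carrier (BijGroup labels)"
      by (simp_all add: local_perms_def)
    then show "f \<otimes>\<^bsub>BijGroup labels\<^esub> g \<in> local_perms K"
      using fg Bij_closed[OF c(2)] by (simp add: local_perms_def Bij_apply)
  qed (auto simp: local_perms_def)
qed

lemma hurwitz_local: "Suc i < K \<Longrightarrow> hurwitz_perm i \<in> local_perms K"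
  using hurwitz_perm_Bij by (auto simp: local_perms_def hurwitz_def fun_eq_iff)

end

section \<open>Faithfulness\<close>

context twists
begin

lemma hurwitz_faithful:
  assumes \<theta>: "\<theta> \<in> hom G (BijGroup labels)"
    and \<theta>_t: "\<And>p q. 1 \<le> p \<Longrightarrow> p < q \<Longrightarrow> q \<le> N \<Longrightarrow>
      \<theta> (t p q) = braid.T (BijGroup labels) hurwitz_perm p q"
    and "M \<le> N" "g \<in> generate G (twist_gens M)" "\<theta> g = \<one>\<^bsub>BijGroup labels\<^esub>"
  shows "g = \<one>"
  using assms(3-5)
proof (induction M arbitrary: g)
  case 0
  then show ?case by (auto simp: twist_gens_def generate_empty)
next
  case (Suc M)
  let ?K = "Suc M"
  interpret H: braid "BijGroup labels" hurwitz_perm N by (rule braid_hurwitz)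
  interpret \<theta>: group_hom G "BijGroup labels" \<theta>
    using \<theta> H.is_group by (simp add: group_hom_def group_hom_axioms_def is_group)
  obtain f g' where g: "g = f \<otimes> g'" "f \<in> generate G (loop_gens ?K)" "g' \<in> generate G (twist_gens M)"
    using twist_decomposition[of M g] Suc.prems by auto
  have [simp]: "f \<in> carrier G" "g' \<in> carrier G"
    using g generate_in_carrier[OF gens_carrier(2)] generate_in_carrier[OF gens_carrier(1)] by auto
  have \<theta>_t': "\<theta> (t p q) = H.T p q" if "1 \<le> p" "q \<le> N" for p q
    using \<theta>_t[of p q] that by (cases "p < q") auto
  have \<theta>_x: "\<theta> (loop ?K r) = H.X r ?K" if "1 \<le> r" for r
    using H.loop_eq_X[of r ?K] that Suc.prems \<theta>_t'[of r ?K] \<theta>_t'[of r M]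
    by (simp add: loop_def H.loop_def del: H.T.simps)
  \<comment> \<open>Quantifying over h makes the property stable under products. The labelling v can
    stay fixed because loops return all labels off the last strand.\<close>
  define moves where "moves = (\<lambda>f c v. \<forall>h\<in>carrier G. \<theta> f (v(?K := (h, \<one>))) = v(?K := (c \<otimes> h, \<one>)))"
  have moves_inv: "moves (inv a) (inv c) v"
    if "moves a c v" "a \<in> carrier G" "c \<in> carrier G" "v \<in> labels" for a c v
    unfolding moves_def
  proof
    fix h assume h: "h \<in> carrier G"
    let ?w = "v(?K := (inv c \<otimes> h, \<one>))"
    have w: "?w \<in> labels" using that h by simp
    have e: "\<theta> a ?w = v(?K := (h, \<one>))"
      using that h by (simp add: moves_def)
    have "\<theta> (inv a) (\<theta> a ?w) = (\<theta> (inv a) \<otimes>\<^bsub>BijGroup labels\<^esub> \<theta> a) ?w"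
      using Bij_apply[of "\<theta> (inv a)" labels "\<theta> a" ?w] that w by simp
    also have "\<dots> = ?w"
      using w that by (simp add: Bij_one)
    finally show "\<theta> (inv a) (v(?K := (h, \<one>))) = ?w" unfolding e .
  qed
  have moves_mult: "moves (a \<otimes> b) (c \<otimes> d) v"
    if "moves a c v" "moves b d v" "a \<in> carrier G" "b \<in> carrier G" "c \<in> carrier G" "d \<in> carrier G"
      "v \<in> labels" for a b c d v
    using that by (simp add: moves_def Bij_apply m_assoc)
  have moves_one: "moves \<one> \<one> v" if "v \<in> labels" for v
    using that by (simp add: moves_def Bij_one)
  have moves_x: "moves (loop ?K r) (label_product r ?K v) v" if "v \<in> labels" "1 \<le> r" for r v
    using hurwitz_loop[of r v _ ?K] that \<theta>_x[of r] by (simp add: moves_def del: label_product.simps)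
  have loops: "\<exists>c\<in>carrier G. moves f c v" if v: "v \<in> labels" for v
    using g(2)
  proof (induction rule: generate.induct)
    case one
    then show ?case using moves_one[OF v] by blast
  next
    case (incl h)
    then obtain r where "h = loop ?K r" "1 \<le> r" by (auto simp: loop_gens_def)
    then show ?case using moves_x[OF v] label_product_closed[OF v] by blast
  next
    case (inv h)
    then obtain r where "h = loop ?K r" "1 \<le> r" by (auto simp: loop_gens_def)
    then show ?case
      using moves_inv[OF moves_x[OF v]] v
      by (intro bexI[of _ "inv (label_product r ?K v)"]) (auto simp del: label_product.simps)
  next
    case (eng a b)
    then show ?case
      using moves_mult[of a _ v b] v generate_in_carrier[OF gens_carrier(2)] by (metis m_closed)
  qed
  have "\<theta> g' v = v" if v: "v \<in> labels" for v
  proof -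
    have "subgroup {a \<in> carrier G. \<theta> a \<in> local_perms ?K} G"
      using subgroup.m_closed[OF subgroup_local_perms] subgroup.m_inv_closed[OF subgroup_local_perms]
        subgroup.one_closed[OF subgroup_local_perms] by (intro subgroupI) auto
    moreover have "twist_gens M \<subseteq> {a \<in> carrier G. \<theta> a \<in> local_perms ?K}"
      using Suc.prems
      by (auto simp: twist_gens_def \<theta>_t' intro!: H.mem_subgroup subgroup_local_perms hurwitz_local)
    ultimately have loc: "\<theta> g' \<in> local_perms ?K"
      using g(3) generate_subgroup_incl by blast
    let ?w = "\<theta> g' v"
    have w: "?w \<in> labels" using v by (simp add: Bij_closed)
    obtain c where c: "c \<in> carrier G" "moves f c ?w" using loops[OF w] by blast
    \<comment> \<open>With a trivial label on strand M + 1, f changes only that label and g' ignores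
      it. Since g acts trivially, g' must fix all labels off this strand.\<close>
    have "v(?K := (\<one>, \<one>)) = \<theta> g (v(?K := (\<one>, \<one>)))"
      using Suc.prems v by (simp add: Bij_one)
    also have "\<dots> = \<theta> f (\<theta> g' (v(?K := (\<one>, \<one>))))"
      using v by (simp add: g Bij_apply)
    also have "\<dots> = \<theta> f (?w(?K := (\<one>, \<one>)))"
      using loc v by (simp add: local_perms_def)
    also have "\<dots> = ?w(?K := (c, \<one>))"
      using c by (simp add: moves_def)
    finally have off: "?w k = v k" if "k \<noteq> ?K" for k
      using that by (metis fun_upd_other)
    have "\<theta> g' (v(?K := v ?K)) = ?w(?K := v ?K)"
      using loc v labels_mem[OF v] unfolding local_perms_def by blast
    then have "?w ?K = v ?K" by (metis fun_upd_same fun_upd_triv)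
    with off show ?thesis by (metis ext)
  qed
  then have "\<theta> g' = \<one>\<^bsub>BijGroup labels\<^esub>"
    by (intro Bij_eqI[of _ labels]) (auto simp: Bij_one)
  then have "g' = \<one>" using Suc.IH[of g'] g(3) Suc.prems by simp
  then have gf: "g = f" using g(1) by simp
  text \<open>For these labels the winding of strand \<open>M + 1\<close> around the others is the braid itself.\<close>
  define v where "v = (\<lambda>k. (\<one>, if 1 \<le> k \<and> k < ?K then loop ?K k \<otimes> inv (loop ?K (Suc k)) else \<one>))"
  have v: "v \<in> labels" unfolding v_def labels_def by simp
  \<comment> \<open>The product telescopes. At q = M + 1 the subtracted loop is trivial, so the
    product is \<open>loop ?K r\<close> itself.\<close>
  have prod: "label_product r q v = loop ?K r \<otimes> inv (loop ?K q)" if "1 \<le> r" "r \<le> q" "q \<le> ?K" for r q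
    using that(2,3)
  proof (induction q rule: dec_induct)
    case base
    then show ?case using that(1) by (cases r) auto
  next
    case (step q)
    then show ?case using that(1) by (simp add: v_def conjugate_def m_assoc)
  qed
  have "moves f f v"
    using g(2)
  proof (induction rule: generate.induct)
    case one
    then show ?case by (rule moves_one[OF v])
  next
    case (incl h)
    then obtain r where r: "h = loop ?K r" "1 \<le> r" "r < ?K" by (auto simp: loop_gens_def)
    then show ?case using moves_x[OF v r(2)] prod[of r ?K] by (simp del: label_product.simps)
  next
    case (inv h)
    then obtain r where r: "h = loop ?K r" "1 \<le> r" "r < ?K" by (auto simp: loop_gens_def)
    then have "moves h h v" using moves_x[OF v r(2)] prod[of r ?K] by (simp del: label_product.simps)
    then show ?case using r v by (intro moves_inv) auto
  next
    case (eng a b)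
    then show ?case
      using v generate_in_carrier[OF gens_carrier(2)] by (intro moves_mult) auto
  qed
  then have "\<theta> f (v(?K := (\<one>, \<one>))) = v(?K := (f, \<one>))" by (simp add: moves_def)
  moreover have "\<theta> f (v(?K := (\<one>, \<one>))) = v(?K := (\<one>, \<one>))"
    using Suc.prems v gf by (simp add: Bij_one)
  ultimately have "v(?K := (f, \<one>)) = v(?K := (\<one>, \<one>))" by simp
  then have "(f, \<one>) = (\<one>, \<one>)" by (metis fun_upd_same)
  then show ?case using gf by simp
qed

end

section \<open>Presented groups\<close>

abbreviation pgen :: "'a set \<Rightarrow> ('a letter list \<times> 'a letter list) set \<Rightarrow> 'a \<Rightarrow> 'a letter list set" where
  "pgen X R a \<equiv> word_class X R [Gen a]"

lemma word_class_closed [simp]: "w \<in> words X \<Longrightarrow> word_class X R w \<in> carrier (presented_group X R)"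
  by (simp add: presented_group_def)

lemma presented_one: "\<one>\<^bsub>presented_group X R\<^esub> = word_class X R []"
  by (simp add: presented_group_def)

lemma word_class_Inv:
  assumes "a \<in> X"
  shows "word_class X R [Inv a] = inv\<^bsub>presented_group X R\<^esub> (pgen X R a)"
proof -
  interpret group "presented_group X R" by (rule group_presented_group)
  have w: "[Gen a] \<in> words X" "[Inv a] \<in> words X" using assms by (auto simp: words_Cons)
  have "word_cong X R ([] @ [Inv a, flip (Inv a)] @ []) ([] @ [])"
    using assms by (intro word_cong.cancel) (auto simp: words_Cons)
  then have "word_class X R [Inv a] \<otimes>\<^bsub>presented_group X R\<^esub> pgen X R a = \<one>\<^bsub>presented_group X R\<^esub>"
    using w mult_word_class[of "[Inv a]" X "[Gen a]" R] word_class_eq_iff[of "[Inv a, Gen a]" X R "[]"]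
    by (simp add: words_Cons presented_one)
  then show ?thesis using w by (simp add: inv_equality)
qed

lemma word_class_eval:
  assumes "w \<in> words X"
  shows "word_class X R w = eval_word (presented_group X R) (pgen X R) w"
  using assms
proof (induction w)
  case Nil
  then show ?case by (simp add: eval_word_def presented_group_def)
next
  case (Cons a w)
  then have "word_class X R (a # w) = word_class X R [a] \<otimes>\<^bsub>presented_group X R\<^esub> word_class X R w"
    using mult_word_class[of "[a]" X w R] by (simp add: words_Cons)
  moreover have "word_class X R [a] = eval_letter (presented_group X R) (pgen X R) a"
    using Cons.prems by (auto simp: words_Cons word_class_Inv)
  ultimately show ?case using Cons by (simp add: eval_word_def words_Cons)
qed

lemma presented_relation:
  assumes "(l, r) \<in> R" "l \<in> words X" "r \<in> words X"
  shows "eval_word (presented_group X R) (pgen X R) l = eval_word (presented_group X R) (pgen X R) r"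
proof -
  have "word_cong X R ([] @ l @ []) ([] @ r @ [])"
    using assms by (intro word_cong.rel) auto
  then show ?thesis
    using assms by (simp add: word_class_eq_iff flip: word_class_eval)
qed

lemma presented_generated:
  assumes "g \<in> carrier (presented_group X R)"
  shows "g \<in> generate (presented_group X R) (pgen X R ` X)"
proof -
  obtain w where w: "w \<in> words X" "g = word_class X R w"
    using assms by (auto simp: presented_group_def)
  have "eval_word (presented_group X R) (pgen X R) w \<in> generate (presented_group X R) (pgen X R ` X)"
    using w(1)
  proof (induction w)
    case Nil
    then show ?case by (simp add: eval_word_def generate.one)
  next
    case (Cons a w)
    then have "eval_letter (presented_group X R) (pgen X R) a \<in> generate (presented_group X R) (pgen X R ` X)"
      by (auto simp: words_Cons intro: generate.incl generate.inv[OF imageI])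
    then show ?case using Cons by (auto simp: eval_word_def words_Cons intro: generate.eng)
  qed
  then show ?thesis using w by (simp add: word_class_eval)
qed

lemma (in group) induced_hom_gen:
  assumes f: "f ` X \<subseteq> carrier G"
    and R: "\<And>l r. (l, r) \<in> R \<Longrightarrow> l \<in> words X \<Longrightarrow> r \<in> words X \<Longrightarrow> eval_word G f l = eval_word G f r"
    and "a \<in> X"
  shows "induced_hom G f (pgen X R a) = f a"
proof -
  have "[Gen a] \<in> words X" "f a \<in> carrier G" using assms by (auto simp: words_Cons)
  then show ?thesis using induced_hom_class[OF f R, where w = "[Gen a]"] by (simp add: eval_word_def)
qed

section \<open>The braid group\<close>

definition braid_gen :: "nat \<Rightarrow> nat \<Rightarrow> nat letter list set" where
  "braid_gen N i = (if i \<in> {1..<N} then pgen {1..<N} (braid_relations N) i else \<one>\<^bsub>braid_group N\<^esub>)"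

lemma group_braid_group: "group (braid_group N)"
  by (simp add: braid_group_def group_presented_group)

lemma braid_gen_closed: "braid_gen N i \<in> carrier (braid_group N)"
  using group.is_monoid[OF group_braid_group]
  by (auto simp: braid_gen_def braid_group_def words_Cons monoid.one_closed)

lemma braid_braid_group: "braid (braid_group N) (braid_gen N) N"
proof -
  interpret group "braid_group N" by (rule group_braid_group)
  note [simp] = braid_gen_closed
  have rel: "eval_word (braid_group N) (braid_gen N) l = eval_word (braid_group N) (braid_gen N) r"
    if "(l, r) \<in> braid_relations N" "l \<in> words {1..<N}" "r \<in> words {1..<N}" for l r
  proof -
    have "eval_word (braid_group N) (braid_gen N) w =
      eval_word (braid_group N) (pgen {1..<N} (braid_relations N)) w" if "w \<in> words {1..<N}" for w
      using that by (induction w) (auto simp: eval_word_def words_Cons braid_gen_def)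
    then show ?thesis using presented_relation[OF that] that by (simp add: braid_group_def)
  qed
  show ?thesis
  proof unfold_locales
    fix i j :: nat assume ij: "i + 2 \<le> j"
    show "braid_gen N i \<otimes>\<^bsub>braid_group N\<^esub> braid_gen N j = braid_gen N j \<otimes>\<^bsub>braid_group N\<^esub> braid_gen N i"
    proof (cases "1 \<le> i \<and> j < N")
      case True
      then have "([Gen i, Gen j], [Gen j, Gen i]) \<in> braid_relations N"
        using ij by (auto simp: braid_relations_def)
      from rel[OF this] True ij show ?thesis by (simp add: words_Cons eval_word_def)
    next
      case False
      then have "braid_gen N i = \<one>\<^bsub>braid_group N\<^esub> \<or> braid_gen N j = \<one>\<^bsub>braid_group N\<^esub>"
        by (auto simp: braid_gen_def)
      then show ?thesis by auto
    qed
  next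
    fix i :: nat assume i: "1 \<le> i" "i + 1 < N"
    then have "([Gen i, Gen (i + 1), Gen i], [Gen (i + 1), Gen i, Gen (i + 1)]) \<in> braid_relations N"
      by (auto simp: braid_relations_def)
    from rel[OF this] i show "braid_gen N i \<otimes>\<^bsub>braid_group N\<^esub> (braid_gen N (i + 1) \<otimes>\<^bsub>braid_group N\<^esub> braid_gen N i)
      = braid_gen N (i + 1) \<otimes>\<^bsub>braid_group N\<^esub> (braid_gen N i \<otimes>\<^bsub>braid_group N\<^esub> braid_gen N (i + 1))"
      by (simp add: words_Cons eval_word_def)
  qed simp
qed

lemma (in braid) T_hom:
  assumes "braid H s' N'" "\<phi> \<in> hom G H"
    and s': "\<And>i. 1 \<le> i \<Longrightarrow> i < N \<Longrightarrow> \<phi> (s i) = s' i" and "1 \<le> p" "q \<le> N"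
  shows "\<phi> (T p q) = braid.T H s' p q"
proof -
  interpret H: braid H s' N' by fact
  interpret \<phi>: group_hom G H \<phi>
    using assms(2) H.is_group by (simp add: group_hom_def group_hom_axioms_def is_group)
  have "q \<le> N \<Longrightarrow> \<phi> (dn p q) = H.dn p q \<and> \<phi> (up p q) = H.up p q" for q
    using assms(4) by (induction q) (auto simp: s')
  then have X: "q \<le> N \<Longrightarrow> \<phi> (X p q) = H.X p q" for q
    by (simp add: X_def H.X_def)
  show ?thesis using assms(5) by (induction q) (auto simp: X)
qed

lemma half_twist_L:
  assumes "1 \<le> i" "i \<le> j" "j < N"
  shows "word_class {1..<N} (braid_relations N) (half_twist_word i j) =
    braid.L (braid_group N) (braid_gen N) i (Suc j)"
proof -
  interpret B: braid "braid_group N" "braid_gen N" N by (rule braid_braid_group)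
  let ?c = "word_class {1..<N} (braid_relations N)"
  have cat: "?c (u @ v) = ?c u \<otimes>\<^bsub>braid_group N\<^esub> ?c v" if "u \<in> words {1..<N}" "v \<in> words {1..<N}" for u v
    using that by (simp add: braid_group_def mult_word_class)
  have nil: "?c [] = \<one>\<^bsub>braid_group N\<^esub>" by (simp add: braid_group_def presented_one)
  have dn: "?c (map Gen (rev [i..<q])) = B.dn i q \<and> map Gen (rev [i..<q]) \<in> words {1..<N}" if "q \<le> N" for q
    using that
  proof (induction q)
    case (Suc q)
    show ?case
    proof (cases "i \<le> q")
      case True
      then have "[Gen q] \<in> words {1..<N}" using Suc.prems assms by (auto simp: words_Cons)
      moreover have "?c [Gen q] = braid_gen N q"
        using Suc.prems True assms by (simp add: braid_gen_def)
      ultimately show ?thesis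
        using Suc True cat[of "[Gen q]" "map Gen (rev [i..<q])"]
        by (simp add: words_Cons)
    qed (use nil in simp)
  qed (use nil in simp)
  have "?c (concat (map (\<lambda>m. map Gen (rev [i..<m + 1])) [i..<q])) = B.L i q \<and>
     concat (map (\<lambda>m. map Gen (rev [i..<m + 1])) [i..<q]) \<in> words {1..<N}" if "q \<le> N" for q
    using that
  proof (induction q)
    case (Suc q)
    show ?case
    proof (cases "i \<le> q")
      case True
      have "[i..<Suc q] = [i..<q] @ [q]" using True by simp
      then show ?thesis
        using Suc True dn[of "Suc q"] cat
        by (simp del: B.dn.simps upt_Suc)
    qed (use nil in simp)
  qed (use nil in simp)
  from this[of "Suc j"] show ?thesis using assms by (simp add: half_twist_word_def del: upt_Suc B.L.simps)
qed

lemma Min_Max_strands: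
  fixes p q :: nat
  assumes "p < q"
  shows "Min {p..<q} = p" "Max {p..<q} = q - 1"
  using assms by (auto intro!: Min_eqI Max_eqI)

lemma half_twist_square:
  assumes "1 \<le> p" "p < q" "q \<le> n + 1"
  shows "half_twist n {p..<q} [^]\<^bsub>braid_group (n + 1)\<^esub> (2::nat) =
    braid.T (braid_group (n + 1)) (braid_gen (n + 1)) p q"
proof -
  interpret B: braid "braid_group (Suc n)" "braid_gen (Suc n)" "Suc n" by (rule braid_braid_group)
  have "half_twist n {p..<q} = B.L p q"
    using half_twist_L[of p "q - 1" "Suc n"] assms by (simp add: half_twist_def Min_Max_strands)
  then show ?thesis
    using B.L_square[of p q] assms by (simp add: numeral_2_eq_2)
qed

section \<open>The group presented by the relations (1) and (2)\<close>

abbreviation twist_presentation :: "nat \<Rightarrow> nat set letter list set monoid" where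
  "twist_presentation n \<equiv> presented_group (connected_subgraphs n) (pure_braid_relations n)"

text \<open>The half-open interval turns strands p, ..., q into nodes p, ..., q - 1. Index pairs
  that name no subgraph get the neutral element, for which (1) is trivial, so the locale axioms hold
  for all indices.\<close>

definition twist_gen :: "nat \<Rightarrow> nat \<Rightarrow> nat \<Rightarrow> nat set letter list set" where
  "twist_gen n p q =
    (if 1 \<le> p \<and> p < q \<and> q \<le> n + 1 then pgen (connected_subgraphs n) (pure_braid_relations n) {p..<q}
     else \<one>\<^bsub>twist_presentation n\<^esub>)"

lemma strands_connected:
  assumes "1 \<le> p" "p < q" "q \<le> n + 1"
  shows "{p..<q} \<in> connected_subgraphs n"
proof -
  have "{p..<q} = {p..q - 1}" using assms by auto
  moreover have "1 \<le> p \<and> p \<le> q - 1 \<and> q - 1 \<le> n" using assms by auto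
  ultimately show ?thesis unfolding connected_subgraphs_def by blast
qed

lemma connected_subgraphs_strands:
  "connected_subgraphs n = {{p..<q} | p q. 1 \<le> p \<and> p < q \<and> q \<le> n + 1}"
proof (intro subset_antisym subsetI)
  fix A assume "A \<in> connected_subgraphs n"
  then obtain i j where "A = {i..j}" "1 \<le> i" "i \<le> j" "j \<le> n"
    by (auto simp: connected_subgraphs_def)
  then have "A = {i..<Suc j} \<and> 1 \<le> i \<and> i < Suc j \<and> Suc j \<le> n + 1" by auto
  then show "A \<in> {{p..<q} | p q. 1 \<le> p \<and> p < q \<and> q \<le> n + 1}" by blast
qed (auto intro: strands_connected)

lemma relation_commute:
  assumes "1 \<le> p" "p < q" "q \<le> n + 1" "1 \<le> r" "r < u" "u \<le> n + 1"
    and "q < r \<or> p \<le> r \<and> u \<le> q"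
  shows "([Gen {p..<q}, Gen {r..<u}], [Gen {r..<u}, Gen {p..<q}]) \<in> pure_braid_relations n"
proof -
  have "{p..<q} \<in> connected_subgraphs n" "{r..<u} \<in> connected_subgraphs n"
    using assms by (auto intro: strands_connected)
  moreover have "subgraph_dist {p..<q} {r..<u} \<ge> 2 \<or> {r..<u} \<subseteq> {p..<q}"
    using assms by (auto simp: subgraph_dist_def Min_Max_strands)
  ultimately show ?thesis unfolding pure_braid_relations_def by blast
qed

lemma relation_lantern:
  assumes "1 \<le> i" "i < a" "a \<le> b" "b < c" "c < M" "M \<le> n + 1"
  shows "([Inv {i..<c}, Gen {i..<b}, Gen {a..<c}, Gen {Suc b..<M}, Inv {a..<M}],
     [Inv {a..<M}, Gen {Suc b..<M}, Gen {a..<c}, Gen {i..<b}, Inv {i..<c}]) \<in> pure_braid_relations n"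
proof -
  have m: "{i..<b} \<in> connected_subgraphs n" "{a..<c} \<in> connected_subgraphs n"
      "{Suc b..<M} \<in> connected_subgraphs n"
    using assms by (auto intro!: strands_connected)
  have "subgraph_dist {i..<b} {Suc b..<M} = 2" "compatible {i..<b} {Suc b..<M} {a..<c}"
    using assms by (auto simp: subgraph_dist_def compatible_def Min_Max_strands)
  moreover have "{i..<b} \<union> {a..<c} = {i..<c}" "{a..<c} \<union> {Suc b..<M} = {a..<M}"
    "{Suc b..<M} \<union> {a..<c} = {a..<M}" "{a..<c} \<union> {i..<b} = {i..<c}"
    using assms by auto
  ultimately show ?thesis
    unfolding pure_braid_relations_def using m by (intro UnI2 CollectI exI[of _ "{i..<b}"]
      exI[of _ "{a..<c}"] exI[of _ "{Suc b..<M}"]) simp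
qed

text \<open>If A lies to the right of C, relation (2) is the equation of the mirrored triple with
  its sides exchanged. The unordered pair \<open>{l, r}\<close> lets one orientation stand for both,
  in (1) as well.\<close>

lemma pure_braid_relationsE:
  assumes "(l, r) \<in> pure_braid_relations n"
  obtains (commute) p q p' q' where "1 \<le> p" "p < q" "q \<le> n + 1" "1 \<le> p'" "p' < q'" "q' \<le> n + 1"
      "q < p' \<or> p \<le> p' \<and> q' \<le> q"
      "{l, r} = {[Gen {p..<q}, Gen {p'..<q'}], [Gen {p'..<q'}, Gen {p..<q}]}"
    | (lantern) i a b c M where "1 \<le> i" "i < a" "a \<le> b" "b < c" "c < M" "M \<le> n + 1"
      "{l, r} = {[Inv {i..<c}, Gen {i..<b}, Gen {a..<c}, Gen {Suc b..<M}, Inv {a..<M}],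
        [Inv {a..<M}, Gen {Suc b..<M}, Gen {a..<c}, Gen {i..<b}, Inv {i..<c}]}"
proof -
  have lan: thesis if ABC: "A \<in> connected_subgraphs n" "B \<in> connected_subgraphs n" "C \<in> connected_subgraphs n"
      "Max A < Min C" "subgraph_dist A C = 2" "Max A + 1 \<in> B" "B \<subseteq> {Min A + 1..Max C - 1}"
      and lr: "{l, r} = {[Inv (A \<union> B), Gen A, Gen B, Gen C, Inv (B \<union> C)],
       [Inv (C \<union> B), Gen C, Gen B, Gen A, Inv (B \<union> A)]}" for A B C
  proof -
    obtain i b where A: "A = {i..<b}" "1 \<le> i" "i < b" "b \<le> n + 1"
      using ABC(1) by (auto simp: connected_subgraphs_strands)
    obtain a c where B: "B = {a..<c}" "1 \<le> a" "a < c" "c \<le> n + 1"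
      using ABC(2) by (auto simp: connected_subgraphs_strands)
    obtain d M where C: "C = {d..<M}" "1 \<le> d" "d < M" "M \<le> n + 1"
      using ABC(3) by (auto simp: connected_subgraphs_strands)
    note mm = Min_Max_strands[OF A(3)] Min_Max_strands[OF C(3)]
    \<comment> \<open>The last node of A is b - 1, so distance 2 places the first node of C at b +
      1.\<close>
    have d: "d = Suc b"
      using ABC(4,5) A C by (auto simp: subgraph_dist_def mm split: if_splits)
    have ab: "a \<le> b" "b < c" using ABC(6) A B by (auto simp: mm)
    have "a \<in> B" "c - 1 \<in> B" using B by auto
    then have "a \<in> {Min A + 1..Max C - 1}" "c - 1 \<in> {Min A + 1..Max C - 1}" using ABC(7) by blast+
    then have ia: "i < a" "c < M" using A B C by (auto simp: mm)
    have "{i..<b} \<union> {a..<c} = {i..<c}" "{a..<c} \<union> {d..<M} = {a..<M}"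
      "{d..<M} \<union> {a..<c} = {a..<M}" "{a..<c} \<union> {i..<b} = {i..<c}"
      using d ab ia A B C by auto
    then show thesis
      using lr A B C d ab ia by (intro lantern[of i a b c M]) simp_all
  qed
  from assms consider A B where "l = [Gen A, Gen B]" "r = [Gen B, Gen A]"
      "A \<in> connected_subgraphs n" "B \<in> connected_subgraphs n" "subgraph_dist A B \<ge> 2 \<or> A \<subseteq> B \<or> B \<subseteq> A"
    | A B C where "l = [Inv (A \<union> B), Gen A, Gen B, Gen C, Inv (B \<union> C)]"
       "r = [Inv (C \<union> B), Gen C, Gen B, Gen A, Inv (B \<union> A)]"
       "A \<in> connected_subgraphs n" "B \<in> connected_subgraphs n" "C \<in> connected_subgraphs n"
       "subgraph_dist A C = 2" "compatible A C B"
    unfolding pure_braid_relations_def by blast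
  then show thesis
  proof cases
    case (1 A B)
    then obtain p q p' q' where A: "A = {p..<q}" "1 \<le> p" "p < q" "q \<le> n + 1"
      and B: "B = {p'..<q'}" "1 \<le> p'" "p' < q'" "q' \<le> n + 1"
      unfolding connected_subgraphs_strands by blast
    consider "q < p'" | "q' < p" | "p \<le> p'" "q' \<le> q" | "p' \<le> p" "q \<le> q'"
      using 1(5) A B by (auto simp: subgraph_dist_def Min_Max_strands split: if_splits)
    then show thesis
    proof cases
      case 2
      then show ?thesis using A B 1(1,2) by (intro commute[of p' q' p q]) auto
    next
      case 4
      then show ?thesis using A B 1(1,2) by (intro commute[of p' q' p q]) auto
    qed (use A B 1(1,2) in \<open>intro commute[of p q p' q']; auto\<close>)+
  next
    case (2 A B C)
    show thesis
    proof (cases "Max A < Min C")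
      case True
      then show thesis using 2 by (intro lan[of A B C]) (auto simp: compatible_def)
    next
      case False
      have "Max C < Min A"
        using 2(3,5,6) False
        by (auto simp: connected_subgraphs_strands subgraph_dist_def Min_Max_strands split: if_splits)
      then show thesis using 2 False
        by (intro lan[of C B A]) (auto simp: compatible_def subgraph_dist_def split: if_splits)
    qed
  qed
qed

lemma twists_presentation: "twists (twist_presentation n) (twist_gen n) (n + 1)"
proof -
  interpret group "twist_presentation n" by (rule group_presented_group)
  let ?Q = "twist_presentation n"
  let ?g = "pgen (connected_subgraphs n) (pure_braid_relations n)"
  note mem = strands_connected[where n = n]
  have closed [simp]: "twist_gen n p q \<in> carrier ?Q" for p q
    using mem[of p q] by (auto simp: twist_gen_def words_Cons)
  have tg: "twist_gen n p q = ?g {p..<q}" if "1 \<le> p" "p < q" "q \<le> n + 1" for p q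
    using that by (simp add: twist_gen_def)
  have triv: "twist_gen n p q = \<one>\<^bsub>?Q\<^esub>" if "\<not> (1 \<le> p \<and> p < q \<and> q \<le> n + 1)" for p q
    using that unfolding twist_gen_def by argo
  have comm: "commute (twist_gen n p q) (twist_gen n r u)" if "q < r \<or> p \<le> r \<and> u \<le> q" for p q r u
  proof (cases "(1 \<le> p \<and> p < q \<and> q \<le> n + 1) \<and> (1 \<le> r \<and> r < u \<and> u \<le> n + 1)")
    case True
    then have R: "([Gen {p..<q}, Gen {r..<u}], [Gen {r..<u}, Gen {p..<q}]) \<in> pure_braid_relations n"
      using that by (intro relation_commute) auto
    show ?thesis
      using presented_relation[OF R, of "connected_subgraphs n"] True mem[of p q] mem[of r u] closed[of p q] closed[of r u]
      by (simp add: words_Cons eval_word_def commute_def tg)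
  next
    case False
    then show ?thesis using triv[of p q] triv[of r u] by (auto simp: commute_def)
  qed
  interpret twists_base "twist_presentation n" "twist_gen n" "n + 1"
    by unfold_locales (auto intro: comm simp: triv)
  show ?thesis
  proof unfold_locales
    fix i a b c M assume A: "1 \<le> i" "i < a" "a \<le> b" "b < c" "c < M" "M \<le> n + 1"
    have m: "{i..<c} \<in> connected_subgraphs n" "{i..<b} \<in> connected_subgraphs n"
      "{a..<c} \<in> connected_subgraphs n" "{Suc b..<M} \<in> connected_subgraphs n"
      "{a..<M} \<in> connected_subgraphs n"
      using A by (auto intro!: mem)
    have e: "twist_gen n i c = ?g {i..<c}" "twist_gen n i b = ?g {i..<b}" "twist_gen n a c = ?g {a..<c}"
      "twist_gen n (Suc b) M = ?g {Suc b..<M}" "twist_gen n a M = ?g {a..<M}"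
      using A by (simp_all add: tg)
    have cl: "?g {a..<M} \<in> carrier ?Q" "?g {i..<c} \<in> carrier ?Q" "?g {i..<b} \<in> carrier ?Q"
      using m by (auto simp: words_Cons)
    show "lantern i a b c M"
      using presented_relation[OF relation_lantern[OF A], of "connected_subgraphs n"] m cl
      unfolding lantern_def e by (simp add: words_Cons eval_word_def)
  qed
qed

theorem theorem1p2:
  fixes n :: nat
  assumes "n \<ge> 1"
  shows "has_presentation (pure_braid_group (n + 1))
           (connected_subgraphs n)
           (\<lambda>A. half_twist n A [^]\<^bsub>braid_group (n + 1)\<^esub> (2::nat))
           (pure_braid_relations n)"
proof -
  let ?N = "Suc n"
  let ?X = "connected_subgraphs n" and ?R = "pure_braid_relations n"
  let ?G = "braid_group ?N" and ?Q = "twist_presentation n"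
  define f where "f = (\<lambda>A. half_twist n A [^]\<^bsub>?G\<^esub> (2::nat))"
  define \<pi> where "\<pi> = braid_perm ?N"
  define \<phi> where "\<phi> = induced_hom ?G f"
  interpret B: braid ?G "braid_gen ?N" ?N by (rule braid_braid_group)
  interpret Q: twists ?Q "twist_gen n" ?N using twists_presentation[of n] by simp
  interpret H: braid "BijGroup Q.labels" Q.hurwitz_perm ?N by (rule Q.braid_hurwitz)
  have \<pi>: "\<pi> \<in> hom ?G (sym_group ?N)" "\<And>i. 1 \<le> i \<Longrightarrow> i < ?N \<Longrightarrow> \<pi> (braid_gen ?N i) = transpose i (i + 1)"
    using braid_perm_hom[of ?N] braid_perm_gen[of _ ?N] by (simp_all add: \<pi>_def braid_gen_def)
  have f_T: "f {p..<q} = B.T p q" if "1 \<le> p" "p < q" "q \<le> ?N" for p q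
    using half_twist_square[of p q n] that by (simp add: f_def)
  have f_closed: "f ` ?X \<subseteq> carrier ?G"
    by (auto simp: connected_subgraphs_strands f_T)
  have f_rel: "eval_word ?G f l = eval_word ?G f r" if "(l, r) \<in> ?R" for l r
    using that
  proof (cases rule: pure_braid_relationsE)
    case (commute p q p' q')
    then have "B.commute (B.T p q) (B.T p' q')"
      using B.t_far[of q p' p q'] B.t_nested[of p p' q' q] by auto
    moreover have "f {p..<q} = B.T p q" "f {p'..<q'} = B.T p' q'" using commute(1-6) by (simp_all add: f_T)
    ultimately have "eval_word ?G f [Gen {p..<q}, Gen {p'..<q'}] = eval_word ?G f [Gen {p'..<q'}, Gen {p..<q}]"
      by (simp add: eval_word_def B.commute_def)
    then show ?thesis using commute(8) by (auto simp: doubleton_eq_iff)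
  next
    case (lantern i a b c M)
    have "f {i..<c} = B.T i c" "f {i..<b} = B.T i b" "f {a..<c} = B.T a c"
      "f {Suc b..<M} = B.T (Suc b) M" "f {a..<M} = B.T a M"
      using lantern(1-6) by (simp_all add: f_T)
    moreover have "B.lantern i a b c M" using lantern(1-6) by (intro B.t_lantern) simp_all
    ultimately have "eval_word ?G f [Inv {i..<c}, Gen {i..<b}, Gen {a..<c}, Gen {Suc b..<M}, Inv {a..<M}]
      = eval_word ?G f [Inv {a..<M}, Gen {Suc b..<M}, Gen {a..<c}, Gen {i..<b}, Inv {i..<c}]"
      by (simp add: eval_word_def B.lantern_def)
    then show ?thesis using lantern(7) by (auto simp: doubleton_eq_iff)
  qed
  have \<phi>: "\<phi> \<in> hom ?Q ?G"
    unfolding \<phi>_def by (intro B.induced_hom_hom f_closed f_rel)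
  have \<phi>_gen: "\<phi> (pgen ?X ?R A) = f A" if "A \<in> ?X" for A
    unfolding \<phi>_def using that by (intro B.induced_hom_gen f_closed f_rel)
  have \<phi>_T: "\<phi> (twist_gen n p q) = B.T p q" if "1 \<le> p" "p < q" "q \<le> ?N" for p q
    using that \<phi>_gen[of "{p..<q}"] f_T[of p q] strands_connected[of p q n] by (simp add: twist_gen_def)
  interpret \<phi>: group_hom ?Q ?G \<phi>
    using \<phi> by (simp add: group_hom_def group_hom_axioms_def B.is_group Q.is_group)
  have Q_gen: "carrier ?Q \<subseteq> generate ?Q (Q.twist_gens ?N)"
  proof -
    have "pgen ?X ?R ` ?X \<subseteq> Q.twist_gens ?N"
      by (auto simp: connected_subgraphs_strands Q.twist_gens_def twist_gen_def)
    then show ?thesis using presented_generated[of _ ?X ?R] Q.mono_generate by blast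
  qed
  have B_gen: "carrier ?G \<subseteq> generate ?G (braid_gen ?N ` {1..<?N})"
    using presented_generated[of _ "{1..<?N}" "braid_relations ?N"]
    by (auto simp: braid_group_def braid_gen_def)
  define \<psi> where "\<psi> = induced_hom (BijGroup Q.labels) Q.hurwitz_perm"
  have \<psi>_rel: "eval_word (BijGroup Q.labels) Q.hurwitz_perm l = eval_word (BijGroup Q.labels) Q.hurwitz_perm r"
    if "(l, r) \<in> braid_relations ?N" for l r
  proof -
    from that consider
      (far) i j where "\<bar>int i - int j\<bar> \<ge> 2" "l = [Gen i, Gen j]" "r = [Gen j, Gen i]"
    | (near) i where "1 \<le> i" "i + 1 < ?N" "l = [Gen i, Gen (i + 1), Gen i]" "r = [Gen (i + 1), Gen i, Gen (i + 1)]"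
      unfolding braid_relations_def by force
    then show ?thesis
    proof cases
      case (far i j)
      from far(1) have "i + 2 \<le> j \<or> j + 2 \<le> i" by linarith
      with far show ?thesis using H.commute_s[of i j] by (simp add: eval_word_def H.commute_def)
    next
      case (near i)
      then show ?thesis using H.s_braid[of i] by (simp add: eval_word_def)
    qed
  qed
  have s_closed: "Q.hurwitz_perm ` {1..<?N} \<subseteq> carrier (BijGroup Q.labels)" by auto
  have \<psi>: "\<psi> \<in> hom ?G (BijGroup Q.labels)"
    unfolding \<psi>_def braid_group_def by (intro H.induced_hom_hom s_closed \<psi>_rel)
  have "\<psi> (braid_gen ?N i) = Q.hurwitz_perm i" if "1 \<le> i" "i < ?N" for i
    using that H.induced_hom_gen[OF s_closed \<psi>_rel, where a = i] by (simp add: \<psi>_def braid_gen_def)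
  then have \<psi>_T: "\<psi> (B.T p q) = H.T p q" if "1 \<le> p" "q \<le> ?N" for p q
    using B.T_hom[OF H.braid_axioms \<psi>] that by blast
  have inj: "inj_on \<phi> (carrier ?Q)"
  proof (rule \<phi>.trivial_ker_imp_inj)
    show "kernel ?Q ?G \<phi> = {\<one>\<^bsub>?Q\<^esub>}"
    proof (intro subset_antisym subsetI)
      fix g assume "g \<in> kernel ?Q ?G \<phi>"
      then have g: "g \<in> carrier ?Q" "\<phi> g = \<one>\<^bsub>?G\<^esub>" by (auto simp: kernel_def)
      \<comment> \<open>The composite sends each generator to the full twist formed from Hurwitz
        moves on labels in the presented group. This is what \<open>hurwitz_faithful\<close> asks
        for, so an element killed by \<phi> is trivial.\<close>
      have "\<psi> \<circ> \<phi> \<in> hom ?Q (BijGroup Q.labels)" using \<phi> \<psi> by (rule hom_compose)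
      moreover have "(\<psi> \<circ> \<phi>) (twist_gen n p q) = H.T p q" if "1 \<le> p" "p < q" "q \<le> ?N" for p q
        using that \<phi>_T \<psi>_T by simp
      moreover have "(\<psi> \<circ> \<phi>) g = \<one>\<^bsub>BijGroup Q.labels\<^esub>"
        using g hom_one[OF \<psi> B.is_group H.is_group] by simp
      ultimately have "g = \<one>\<^bsub>?Q\<^esub>"
        using Q.hurwitz_faithful[of "\<psi> \<circ> \<phi>" ?N g] g(1) Q_gen by blast
      then show "g \<in> {\<one>\<^bsub>?Q\<^esub>}" by simp
    qed (auto simp: kernel_def)
  qed
  have surj: "\<phi> ` carrier ?Q = kernel ?G (sym_group ?N) \<pi>"
  proof
    interpret \<pi>: group_hom ?G "sym_group ?N" \<pi>
      using \<pi>(1) by (simp add: group_hom_def group_hom_axioms_def B.is_group sym_group_is_group)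
    show "\<phi> ` carrier ?Q \<subseteq> kernel ?G (sym_group ?N) \<pi>"
    proof -
      have "\<phi> ` carrier ?Q \<subseteq> \<phi> ` generate ?Q (Q.twist_gens ?N)" using Q_gen by blast
      also have "\<dots> = generate ?G (\<phi> ` Q.twist_gens ?N)"
        by (rule \<phi>.generate_img[OF Q.gens_carrier(1), symmetric])
      also have "\<dots> \<subseteq> kernel ?G (sym_group ?N) \<pi>"
      proof (rule B.generate_subgroup_incl[OF _ \<pi>.subgroup_kernel])
        show "\<phi> ` Q.twist_gens ?N \<subseteq> kernel ?G (sym_group ?N) \<pi>"
          using B.pure_words(2)[OF \<pi>]
          by (auto simp: Q.twist_gens_def kernel_def sym_group_one \<phi>_T simp del: B.T.simps)
      qed
      finally show ?thesis .
    qed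
    have "B.twist_gens ?N \<subseteq> \<phi> ` carrier ?Q"
    proof
      fix g assume "g \<in> B.twist_gens ?N"
      then obtain p q where "g = B.T p q" "1 \<le> p" "p < q" "q \<le> ?N" by (auto simp: B.twist_gens_def)
      then have "g = \<phi> (twist_gen n p q)" by (simp add: \<phi>_T)
      then show "g \<in> \<phi> ` carrier ?Q" by simp
    qed
    then have "generate ?G (B.twist_gens ?N) \<subseteq> \<phi> ` carrier ?Q"
      by (rule B.generate_subgroup_incl[OF _ \<phi>.img_is_subgroup])
    moreover have "kernel ?G (sym_group ?N) \<pi> \<subseteq> generate ?G (B.twist_gens ?N)"
      using B.pure_generated[OF \<pi> order_refl] B_gen by (auto simp: kernel_def sym_group_one)
    ultimately show "kernel ?G (sym_group ?N) \<pi> \<subseteq> \<phi> ` carrier ?Q" by blast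
  qed
  have "\<phi> \<in> iso ?Q (pure_braid_group ?N)"
    using \<phi> inj surj
    by (auto simp: iso_def hom_def bij_betw_def pure_braid_group_def \<pi>_def)
  then show ?thesis
    using \<phi>_gen by (auto simp: has_presentation_def f_def)
qed

end
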